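(* Let $m>1$ and define $$\mathscr L_m=\Delta+2(m-1)\frac{x}{|x|^2}\cdot\nabla+\frac{(m-1)^2}{|x|^2}.$$ For all $\alpha>0$, there exists a universal constant $C_{m,\alpha}<\infty$ (depending only on $m$ and $\alpha$) with the following property. Fix $0<a<b<\infty$ and let $\Omega=B_b\setminus\overline{B}_a(0)\subset\mathbb R^2$. Then, for all $u\in W^{2,2}_0(\Omega)$, we have $$\int_\Omega\frac{u^2}{|x|^4}\left(\left(\frac{|x|}{b}\right)^\alpha+\left(\frac{a}{|x|}\right)^\alpha\right)dx\le C_{m,\alpha}\int_\Omega(\mathscr L_mu)^2dx$$ and $$\int_\Omega\frac{|\nabla u|^2}{|x|^2}\left(\left(\frac{|x|}{b}\right)^\alpha+\left(\frac{a}{|x|}\right)^\alpha\right)dx\le C_{m,\alpha}\int_\Omega(\mathscr L_mu)^2dx.$$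
   Context: $B_r$ is the open disc of radius $r$ centred at $0$ in $\mathbb R^2$; functions are real-valued; $W^{2,2}_0(\Omega)$ is the closure of $C^\infty_c(\Omega)$ in $W^{2,2}(\Omega)$; $m$ is a real number. *)

theory Defs
  imports "HOL-Analysis.Analysis"
begin

text \<open>Function spaces on an open set \<open>\<Omega>\<close> of \<open>real ^ 'n\<close>. An element of such a space is a total
  function \<open>real ^ 'n \<Rightarrow> real\<close>; only its values on \<open>\<Omega>\<close>, up to a Lebesgue null set, matter.\<close>

definition partial :: "'n::finite \<Rightarrow> (real ^ 'n \<Rightarrow> real) \<Rightarrow> real ^ 'n \<Rightarrow> real" where
  "partial i f x = frechet_derivative f (at x) (axis i 1)"

text \<open>If all iterated partial derivatives are differentiable, they are all continuous, so this is
  the class \<open>C\<^sup>\<infinity>\<close> on the whole space.\<close>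

definition smooth :: "(real ^ 'n::finite \<Rightarrow> real) \<Rightarrow> bool" where
  "smooth f \<longleftrightarrow> (\<forall>is x. foldr partial is f differentiable (at x))"

definition test_functions :: "(real ^ 'n::finite) set \<Rightarrow> (real ^ 'n \<Rightarrow> real) set" where
  "test_functions \<Omega> =
     {\<phi>. smooth \<phi> \<and> compact (closure {x. \<phi> x \<noteq> 0}) \<and> closure {x. \<phi> x \<noteq> 0} \<subseteq> \<Omega>}"

definition locally_integrable_on :: "(real ^ 'n::finite \<Rightarrow> real) \<Rightarrow> (real ^ 'n) set \<Rightarrow> bool" where
  "locally_integrable_on f \<Omega> \<longleftrightarrow> (\<forall>K. compact K \<and> K \<subseteq> \<Omega> \<longrightarrow> set_integrable lebesgue K f)"

definition L2 :: "(real ^ 'n::finite) set \<Rightarrow> (real ^ 'n \<Rightarrow> real) set" where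
  "L2 \<Omega> = {f. set_borel_measurable lebesgue \<Omega> f \<and> set_integrable lebesgue \<Omega> (\<lambda>x. (f x)\<^sup>2)}"

definition has_weak_partial ::
  "(real ^ 'n::finite) set \<Rightarrow> 'n \<Rightarrow> (real ^ 'n \<Rightarrow> real) \<Rightarrow> (real ^ 'n \<Rightarrow> real) \<Rightarrow> bool" where
  "has_weak_partial \<Omega> i u v \<longleftrightarrow>
     locally_integrable_on u \<Omega> \<and> locally_integrable_on v \<Omega> \<and>
     (\<forall>\<phi>\<in>test_functions \<Omega>.
        (LINT x:\<Omega>|lebesgue. u x * partial i \<phi> x) = - (LINT x:\<Omega>|lebesgue. v x * \<phi> x))"

text \<open>A weak derivative is unique only up to a null set; \<open>weak_partial\<close> is some representative,
  meaningful only if \<open>weakly_differentiable\<close> holds.\<close>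

definition weakly_differentiable ::
  "(real ^ 'n::finite) set \<Rightarrow> 'n \<Rightarrow> (real ^ 'n \<Rightarrow> real) \<Rightarrow> bool" where
  "weakly_differentiable \<Omega> i u \<longleftrightarrow> (\<exists>v. has_weak_partial \<Omega> i u v)"

definition weak_partial ::
  "(real ^ 'n::finite) set \<Rightarrow> 'n \<Rightarrow> (real ^ 'n \<Rightarrow> real) \<Rightarrow> real ^ 'n \<Rightarrow> real" where
  "weak_partial \<Omega> i u = (SOME v. has_weak_partial \<Omega> i u v)"

definition weak_gradient ::
  "(real ^ 'n::finite) set \<Rightarrow> (real ^ 'n \<Rightarrow> real) \<Rightarrow> real ^ 'n \<Rightarrow> real ^ 'n" where
  "weak_gradient \<Omega> u x = (\<chi> i. weak_partial \<Omega> i u x)"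

definition weak_laplacian ::
  "(real ^ 'n::finite) set \<Rightarrow> (real ^ 'n \<Rightarrow> real) \<Rightarrow> real ^ 'n \<Rightarrow> real" where
  "weak_laplacian \<Omega> u x = (\<Sum>i\<in>UNIV. weak_partial \<Omega> i (weak_partial \<Omega> i u) x)"

definition W22 :: "(real ^ 'n::finite) set \<Rightarrow> (real ^ 'n \<Rightarrow> real) set" where
  "W22 \<Omega> = {u. u \<in> L2 \<Omega> \<and>
     (\<forall>i. weakly_differentiable \<Omega> i u \<and> weak_partial \<Omega> i u \<in> L2 \<Omega>) \<and>
     (\<forall>i j. weakly_differentiable \<Omega> j (weak_partial \<Omega> i u) \<and>
            weak_partial \<Omega> j (weak_partial \<Omega> i u) \<in> L2 \<Omega>)}"

definition W22_norm :: "(real ^ 'n::finite) set \<Rightarrow> (real ^ 'n \<Rightarrow> real) \<Rightarrow> real" where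
  "W22_norm \<Omega> u = sqrt (
     (LINT x:\<Omega>|lebesgue. (u x)\<^sup>2) +
     (\<Sum>i\<in>UNIV. LINT x:\<Omega>|lebesgue. (weak_partial \<Omega> i u x)\<^sup>2) +
     (\<Sum>i\<in>UNIV. \<Sum>j\<in>UNIV. LINT x:\<Omega>|lebesgue. (weak_partial \<Omega> j (weak_partial \<Omega> i u) x)\<^sup>2))"

definition W22_0 :: "(real ^ 'n::finite) set \<Rightarrow> (real ^ 'n \<Rightarrow> real) set" where
  "W22_0 \<Omega> =
     {u \<in> W22 \<Omega>. \<forall>\<epsilon>>0. \<exists>\<phi>\<in>test_functions \<Omega>. W22_norm \<Omega> (\<lambda>x. u x - \<phi> x) < \<epsilon>}"

definition annulus :: "real \<Rightarrow> real \<Rightarrow> (real ^ 2) set" where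
  "annulus a b = ball 0 b - closure (ball 0 a)"

definition L_op :: "real \<Rightarrow> (real ^ 2) set \<Rightarrow> (real ^ 2 \<Rightarrow> real) \<Rightarrow> real ^ 2 \<Rightarrow> real" where
  "L_op m \<Omega> u x =
     weak_laplacian \<Omega> u x
     + 2 * (m - 1) * ((x /\<^sub>R (norm x)\<^sup>2) \<bullet> weak_gradient \<Omega> u x)
     + (m - 1)\<^sup>2 / (norm x)\<^sup>2 * u x"

end

theory Submission
  imports Defs
begin

text \<open>With \<open>w = u / |x|\<close>, \<open>E = x \<cdot> \<nabla>\<close> and \<open>R = x\<^sub>1 \<partial>\<^sub>2 - x\<^sub>2 \<partial>\<^sub>1\<close> (the derivatives along \<open>log |x|\<close> and
  the angle) one has \<open>|x| L\<^sub>m u = S w + 2 m E w\<close> with \<open>S = E\<^sup>2 + m\<^sup>2 + R\<^sup>2\<close>. For the measure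
  \<open>dx / |x|\<^sup>2\<close> the operators \<open>E\<close> and \<open>R\<close> are antisymmetric and commute, so \<open>S w\<close> and \<open>E w\<close> are
  orthogonal and \<open>\<parallel>L\<^sub>m u\<parallel>\<^sup>2 = \<parallel>S w\<parallel>\<^sup>2 + 4 m\<^sup>2 \<parallel>E w\<parallel>\<^sup>2\<close>. The two weights are eigenfunctions of \<open>E\<close> with
  eigenvalues \<open>\<alpha>\<close> and \<open>- \<alpha>\<close>, and are bounded by \<open>1\<close>; a Hardy inequality therefore bounds the weighted
  norm of \<open>w\<close> by the norm of \<open>E w\<close>, and testing \<open>S w\<close> against the weighted \<open>w\<close> bounds that of \<open>R w\<close>.
  Everything passes from test functions to \<open>W\<^sup>2\<^sup>,\<^sup>2\<^sub>0\<close> because on an annulus all terms are continuous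
  in the Sobolev norm, and weak derivatives are unique by the fundamental lemma of the calculus of
  variations.\<close>

section \<open>The fundamental lemma of the calculus of variations\<close>

text \<open>The measure dx / |x|^2 is d(log |x|) d(angle), and |x|^2 L_m = (E + m - 1)^2 + R^2. The
  factor |x| between u and w turns the L^2 norm of L_m u into a norm for this measure and shifts the
  operator to (E + m)^2 + R^2. For integer m the function cos (m * angle) is annihilated by both S
  and E. Cutting it off on ever thicker annuli shows that no unweighted bound is uniform in b / a;
  the weights, decaying exponentially in log |x| away from one boundary circle, are what makes
  uniformity possible. Of a weight only its eigenvalue and the bounds 0 and 1 enter, so the
  constants are free of a and b. The sum of the two weights is not an eigenfunction of E, hence each
  is treated alone. The final constant is \<open>8 * energy_const m \<alpha>\<close>: a factor 2 for
  the two weights, and a factor 4 for comparing u with a test function on both sides of the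
  inequality. Weak derivatives are representatives picked by choice. Only their uniqueness lets the
  Sobolev norm of a difference control the difference of the chosen derivatives.\<close>

fun differentiable_upto :: "nat \<Rightarrow> (real \<Rightarrow> real) \<Rightarrow> bool" where
  "differentiable_upto 0 f \<longleftrightarrow> True"
| "differentiable_upto (Suc n) f \<longleftrightarrow>
     (\<exists>f'. (\<forall>x. (f has_real_derivative f' x) (at x)) \<and> differentiable_upto n f')"

lemma differentiable_upto_Suc_imp:
  "differentiable_upto (Suc n) f \<Longrightarrow> differentiable_upto n f"
proof (induction n arbitrary: f)
  case (Suc n)
  then obtain f' where "\<forall>x. (f has_real_derivative f' x) (at x)" "differentiable_upto (Suc n) f'"
    by (metis differentiable_upto.simps(2))
  with Suc.IH show ?case
    by auto
qed simp

lemma differentiable_upto_add: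
  "differentiable_upto n f \<Longrightarrow> differentiable_upto n g \<Longrightarrow> differentiable_upto n (\<lambda>x. f x + g x)"
proof (induction n arbitrary: f g)
  case (Suc n)
  then obtain f' g' where "\<forall>x. (f has_real_derivative f' x) (at x)" "differentiable_upto n f'"
    "\<forall>x. (g has_real_derivative g' x) (at x)" "differentiable_upto n g'"
    by auto
  then show ?case
    using Suc.IH[of f' g'] by (auto intro!: exI[of _ "\<lambda>x. f' x + g' x"] DERIV_add)
qed simp

lemma differentiable_upto_mult:
  "differentiable_upto n f \<Longrightarrow> differentiable_upto n g \<Longrightarrow> differentiable_upto n (\<lambda>x. f x * g x)"
proof (induction n arbitrary: f g)
  case (Suc n)
  then obtain f' g' where *: "\<forall>x. (f has_real_derivative f' x) (at x)" "differentiable_upto n f'"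
    "\<forall>x. (g has_real_derivative g' x) (at x)" "differentiable_upto n g'"
    by auto
  \<comment> \<open>In each term of the product rule one factor is still differentiable to order Suc
    n; it is lowered to order n before the induction hypothesis applies.\<close>
  have "differentiable_upto n (\<lambda>x. f' x * g x + g' x * f x)"
    using Suc.IH[of f' g] Suc.IH[of g' f] Suc.prems * differentiable_upto_Suc_imp
    by (intro differentiable_upto_add) auto
  then show ?case
    using * by (auto intro!: exI[of _ "\<lambda>x. f' x * g x + g' x * f x"] DERIV_mult)
qed simp

lemma differentiable_upto_const: "differentiable_upto n (\<lambda>x. c)"
proof (induction n arbitrary: c)
  case (Suc n)
  show ?case
    using Suc.IH[of 0] by (auto intro!: exI[of _ "\<lambda>x. 0"])
qed simp

lemma differentiable_upto_affine:
  "differentiable_upto n f \<Longrightarrow> differentiable_upto n (\<lambda>x. f (c * x + d))"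
proof (induction n arbitrary: f)
  case (Suc n)
  then obtain f' where *: "\<forall>x. (f has_real_derivative f' x) (at x)" "differentiable_upto n f'"
    by auto
  have "((\<lambda>x. f (c * x + d)) has_real_derivative f' (c * x + d) * c) (at x)" for x
    by (rule DERIV_chain2[OF *(1)[rule_format]]) (auto intro!: derivative_eq_intros)
  moreover have "differentiable_upto n (\<lambda>x. f' (c * x + d) * c)"
    using Suc.IH[of f'] * by (intro differentiable_upto_mult differentiable_upto_const) auto
  ultimately show ?case
    by (auto intro!: exI[of _ "\<lambda>x. f' (c * x + d) * c"])
qed simp

text \<open>The classical flat function exp (-1/t) is the case p = 1. The polynomial in 1/t makes
  the family closed under differentiation, so that a single differentiability proof yields all
  orders.\<close>

definition flat_exp :: "real poly \<Rightarrow> real \<Rightarrow> real" where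
  "flat_exp p t = (if t > 0 then poly p (1 / t) * exp (- (1 / t)) else 0)"

lemma poly_times_exp_minus_tendsto_0:
  "((\<lambda>s::real. poly p s * exp (- s)) \<longlongrightarrow> 0) at_top"
proof -
  have "((\<lambda>s::real. \<Sum>i\<le>degree p. coeff p i * (s ^ i / exp s)) \<longlongrightarrow> (\<Sum>i\<le>degree p. coeff p i * 0)) at_top"
    by (intro tendsto_intros tendsto_power_div_exp_0)
  then show ?thesis
    by (simp add: poly_altdef sum_distrib_right exp_minus divide_inverse mult.assoc)
qed

lemma flat_exp_tendsto_0: "(flat_exp p \<longlongrightarrow> 0) (at 0)"
proof -
  have "(flat_exp p \<longlongrightarrow> 0) (at_left 0)"
    by (rule Lim_transform_eventually[OF tendsto_const])
       (auto simp: flat_exp_def eventually_at_filter)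
  moreover have "((\<lambda>t. poly p (inverse t) * exp (- inverse t)) \<longlongrightarrow> 0) (at_right (0::real))"
    by (rule filterlim_compose[OF poly_times_exp_minus_tendsto_0 filterlim_inverse_at_top_right])
  then have "(flat_exp p \<longlongrightarrow> 0) (at_right 0)"
    by (rule Lim_transform_eventually)
       (auto simp: flat_exp_def eventually_at_filter field_simps)
  ultimately show ?thesis
    by (rule filterlim_split_at)
qed

text \<open>For t > 0 the derivative of p(1/t) exp (-1/t) is (1/t)^2 (p - p')(1/t) exp (-1/t), and
  \<open>[:0, 0, 1:]\<close> is the square of the variable. At 0 the exponential beats every power
  of 1/t.\<close>

lemma flat_exp_has_derivative:
  "(flat_exp p has_real_derivative flat_exp ([:0, 0, 1:] * (p - pderiv p)) t) (at t)"
proof -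
  consider "t > 0" | "t < 0" | "t = 0" by linarith
  then show ?thesis
  proof cases
    case 1
    have "((\<lambda>t. poly p (1 / t) * exp (- (1 / t))) has_real_derivative
        flat_exp ([:0, 0, 1:] * (p - pderiv p)) t) (at t)"
      using 1
      by (auto intro!: derivative_eq_intros DERIV_chain2[OF poly_DERIV]
          simp: flat_exp_def field_simps power2_eq_square)
    then show ?thesis
      by (rule has_field_derivative_transform_within_open[where S="{0<..}"])
        (use 1 in \<open>auto simp: flat_exp_def\<close>)
  next
    case 2
    have "((\<lambda>t. 0) has_real_derivative flat_exp ([:0, 0, 1:] * (p - pderiv p)) t) (at t)"
      using 2 by (auto simp: flat_exp_def)
    then show ?thesis
      by (rule has_field_derivative_transform_within_open[where S="{..<0}"])
        (use 2 in \<open>auto simp: flat_exp_def\<close>)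
  next
    case 3
    \<comment> \<open>Dividing by y multiplies the polynomial by its variable, so the difference
      quotient is itself the member \<open>flat_exp (pCons 0 p)\<close> of the family.\<close>
    have "((\<lambda>y. (flat_exp p y - flat_exp p 0) / (y - 0)) \<longlongrightarrow> 0) (at 0)"
      by (rule Lim_transform_eventually[OF flat_exp_tendsto_0[of "pCons 0 p"]])
         (auto simp: flat_exp_def eventually_at_filter field_simps)
    then show ?thesis
      using 3 by (simp add: has_field_derivative_iff flat_exp_def)
  qed
qed

lemma differentiable_upto_flat_exp: "differentiable_upto n (flat_exp p)"
  by (induction n arbitrary: p) (auto intro!: exI flat_exp_has_derivative)

lemma has_derivative_prod_components:
  fixes g :: "'n::finite \<Rightarrow> real \<Rightarrow> real"
  assumes "\<And>i x. (g i has_real_derivative g' i x) (at x)"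
  shows "((\<lambda>x::real^'n. \<Prod>i\<in>UNIV. g i (x $ i)) has_derivative
    (\<lambda>h. \<Sum>i\<in>UNIV. g' i (x $ i) * h $ i * (\<Prod>j\<in>UNIV - {i}. g j (x $ j)))) (at x)"
proof -
  have "((\<lambda>x. g i (x $ i)) has_derivative (\<lambda>h. g' i (x $ i) * h $ i)) (at x)" for i
    by (rule DERIV_compose_FDERIV[OF assms, THEN has_derivative_eq_rhs])
       (auto intro!: derivative_eq_intros bounded_linear_vec_nth bounded_linear_imp_has_derivative)
  then show ?thesis
    by (intro has_derivative_prod) auto
qed

lemma partial_prod_components:
  fixes g :: "'n::finite \<Rightarrow> real \<Rightarrow> real"
  assumes "\<And>i x. (g i has_real_derivative g' i x) (at x)"
  shows "partial k (\<lambda>x::real^'n. \<Prod>i\<in>UNIV. g i (x $ i)) =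
    (\<lambda>x. \<Prod>i\<in>UNIV. (g(k := g' k)) i (x $ i))"
proof
  fix x :: "real^'n"
  have "partial k (\<lambda>x::real^'n. \<Prod>i\<in>UNIV. g i (x $ i)) x =
     (\<Sum>i\<in>UNIV. g' i (x $ i) * axis k 1 $ i * (\<Prod>j\<in>UNIV - {i}. g j (x $ j)))"
    unfolding partial_def
    by (subst frechet_derivative_at[OF has_derivative_prod_components[where g'=g', OF assms], symmetric]) simp
  also have "\<dots> = (\<Sum>i\<in>{k}. g' i (x $ i) * axis k 1 $ i * (\<Prod>j\<in>UNIV - {i}. g j (x $ j)))"
    by (rule sum.mono_neutral_right) (auto simp: axis_def)
  also have "\<dots> = (\<Prod>i\<in>UNIV. (g(k := g' k)) i (x $ i))"
    by (subst prod.remove[of _ k]) (auto simp: axis_def intro!: prod.cong)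
  finally show "partial k (\<lambda>x::real^'n. \<Prod>i\<in>UNIV. g i (x $ i)) x = \<dots>" .
qed

text \<open>Partial differentiation replaces one factor of the product by its derivative. Iterated
  partials therefore remain products of smooth one-variable functions, and only differentiability of
  such a product is left to check.\<close>

lemma smooth_prod_components:
  fixes g :: "'n::finite \<Rightarrow> real \<Rightarrow> real"
  assumes "\<And>i n. differentiable_upto n (g i)"
  shows "smooth (\<lambda>x::real^'n. \<Prod>i\<in>UNIV. g i (x $ i))"
proof -
  \<comment> \<open>The witness in \<open>differentiable_upto\<close> might change with n;
    uniqueness of derivatives identifies it with \<open>deriv f\<close> for all n at once.\<close>
  have deriv: "\<exists>f'. (\<forall>x. (f has_real_derivative f' x) (at x)) \<and> (\<forall>n. differentiable_upto n f')"
    if f: "\<And>n. differentiable_upto n f" for f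
  proof (intro exI[of _ "deriv f"] conjI allI)
    fix n
    obtain f' where f': "\<forall>x. (f has_real_derivative f' x) (at x)" "differentiable_upto n f'"
      using f[of "Suc n"] by auto
    then have "f' = deriv f"
      by (auto intro!: DERIV_imp_deriv[symmetric])
    with f' show "(f has_real_derivative deriv f x) (at x)" "differentiable_upto n (deriv f)" for x
      by auto
  qed
  have closed: "\<exists>g. (\<forall>i n. differentiable_upto n (g i)) \<and>
      foldr partial is (\<lambda>x::real^'n. \<Prod>i\<in>UNIV. g0 i (x $ i)) = (\<lambda>x. \<Prod>i\<in>UNIV. g i (x $ i))"
    if "\<And>i n. differentiable_upto n (g0 i)" for "is" and g0 :: "'n \<Rightarrow> real \<Rightarrow> real"
  proof (induction "is")
    case Nil
    show ?case using that by (intro exI[of _ g0]) simp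
  next
    case (Cons k "is")
    then obtain g where g: "\<And>i n. differentiable_upto n (g i)"
      "foldr partial is (\<lambda>x::real^'n. \<Prod>i\<in>UNIV. g0 i (x $ i)) = (\<lambda>x. \<Prod>i\<in>UNIV. g i (x $ i))"
      by blast
    obtain g' where g': "\<And>i x. (g i has_real_derivative g' i x) (at x)"
        "\<And>i n. differentiable_upto n (g' i)"
      using deriv[OF g(1)] by metis
    show ?case
      using g g' by (intro exI[of _ "g(k := g' k)"]) (auto simp: partial_prod_components[where g'=g'])
  qed
  have diff: "(\<lambda>x::real^'n. \<Prod>i\<in>UNIV. g i (x $ i)) differentiable (at x)"
    if g: "\<And>i n. differentiable_upto n (g i)" for x and g :: "'n \<Rightarrow> real \<Rightarrow> real"
  proof -
    obtain g' where g': "\<And>i x. (g i has_real_derivative g' i x) (at x)"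
      using deriv[OF g] by metis
    show ?thesis
      using has_derivative_prod_components[where g'=g', OF g'] by (auto simp: differentiable_def)
  qed
  have "foldr partial is (\<lambda>x::real^'n. \<Prod>i\<in>UNIV. g i (x $ i)) differentiable (at x)" for "is" x
  proof -
    obtain g1 where "\<And>i n. differentiable_upto n (g1 i)"
      "foldr partial is (\<lambda>x::real^'n. \<Prod>i\<in>UNIV. g i (x $ i)) = (\<lambda>x. \<Prod>i\<in>UNIV. g1 i (x $ i))"
      using closed[of g "is"] assms by blast
    then show ?thesis
      using diff[of g1 x] by simp
  qed
  then show ?thesis
    unfolding smooth_def by blast
qed

text \<open>The parameter k sharpens the bump: exp (-1/(k t)) tends to 1 for t > 0 while the factor
  stays 0 for t \<le> 0. The bumps thus tend to the indicator of the open box and stay between 0 and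
  1 without any normalisation. The product form reduces smoothness to one variable.\<close>

definition box_bump :: "real^'n \<Rightarrow> real^'n \<Rightarrow> nat \<Rightarrow> real^'n::finite \<Rightarrow> real" where
  "box_bump c d k x =
     (\<Prod>i\<in>UNIV. flat_exp 1 (real k * (x $ i - c $ i)) * flat_exp 1 (real k * (d $ i - x $ i)))"

lemma smooth_box_bump: "smooth (box_bump c d k)"
proof -
  have "differentiable_upto n (\<lambda>t. flat_exp 1 (real k * (t - a)) * flat_exp 1 (real k * (b - t)))" for n a b
    using differentiable_upto_mult[OF
        differentiable_upto_affine[OF differentiable_upto_flat_exp, of n 1 "real k" "- real k * a"]
        differentiable_upto_affine[OF differentiable_upto_flat_exp, of n 1 "- real k" "real k * b"]]
    by (simp add: algebra_simps)
  then show ?thesis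
    unfolding box_bump_def by (intro smooth_prod_components)
qed

lemma box_bump_outside:
  assumes "x \<notin> box c d" shows "box_bump c d k x = 0"
proof -
  from assms obtain i where "\<not> (c $ i < x $ i \<and> x $ i < d $ i)"
    by (auto simp: mem_box_cart)
  then have "flat_exp 1 (real k * (x $ i - c $ i)) * flat_exp 1 (real k * (d $ i - x $ i)) = 0"
    by (auto simp: flat_exp_def zero_less_mult_iff)
  then show ?thesis
    unfolding box_bump_def by (auto intro!: prod_zero)
qed

lemma box_bump_bounds: "0 \<le> box_bump c d k x" "box_bump c d k x \<le> 1"
proof -
  have *: "0 \<le> flat_exp 1 t" "flat_exp 1 t \<le> 1" for t
    by (auto simp: flat_exp_def)
  show "0 \<le> box_bump c d k x"
    unfolding box_bump_def by (intro prod_nonneg ballI mult_nonneg_nonneg *)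
  show "box_bump c d k x \<le> 1"
    unfolding box_bump_def by (intro prod_le_1) (simp add: * mult_le_one)
qed

lemma box_bump_tendsto_indicator: "(\<lambda>k. box_bump c d k x) \<longlonglongrightarrow> indicator (box c d) x"
proof (cases "x \<in> box c d")
  case True
  have lim: "(\<lambda>k. flat_exp 1 (real k * t)) \<longlonglongrightarrow> 1" if "t > 0" for t
  proof -
    have "(\<lambda>k. exp (- (inverse (real k) / t))) \<longlonglongrightarrow> exp (- (0 / t))"
      using that by (intro tendsto_intros lim_inverse_n) auto
    then show ?thesis
      using that
      by (subst tendsto_cong[OF eventually_mono[OF eventually_gt_at_top[of 0]], of _ "\<lambda>k. exp (- (inverse (real k) / t))"])
         (auto simp: flat_exp_def field_simps)
  qed
  have "(\<lambda>k. box_bump c d k x) \<longlonglongrightarrow> (\<Prod>i\<in>(UNIV::'a set). 1 * 1)"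
    unfolding box_bump_def using True
    by (intro tendsto_intros lim) (auto simp: mem_box_cart)
  then show ?thesis using True by simp
qed (simp add: box_bump_outside)

lemma box_bump_in_test_functions:
  assumes "cbox c d \<subseteq> \<Omega>" shows "box_bump c d k \<in> test_functions \<Omega>"
proof -
  have "closure {x. box_bump c d k x \<noteq> 0} \<subseteq> cbox c d"
    using box_bump_outside box_subset_cbox by (intro closure_minimal closed_cbox) blast
  moreover from this have "compact (closure {x. box_bump c d k x \<noteq> 0})"
    by (metis bounded_cbox bounded_subset compact_eq_bounded_closed closed_closure)
  ultimately show ?thesis
    using assms smooth_box_bump by (auto simp: test_functions_def)
qed

section \<open>From vanishing box integrals to vanishing almost everywhere\<close>

text \<open>Lebesgue differentiation: off a negligible set the value f x is the limit of the
  averages of f over cubes with corner x, and all these averages are 0.\<close>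

lemma AE_eq_0_if_integral_cbox_eq_0:
  fixes f :: "'a::euclidean_space \<Rightarrow> real"
  assumes "\<And>c d. (f has_integral 0) (cbox c d)"
  shows "AE x in lebesgue. f x = 0"
proof -
  obtain N where N: "negligible N"
    "\<And>x e. \<lbrakk>x \<notin> N; 0 < e\<rbrakk> \<Longrightarrow>
       \<exists>d>0. \<forall>h. 0 < h \<and> h < d \<longrightarrow>
         norm (integral (cbox x (x + h *\<^sub>R One)) f /\<^sub>R h ^ DIM('a) - f x) < e"
    using integrable_ccontinuous_explicit[of f] assms by blast
  have "f x = 0" if "x \<notin> N" for x
  proof (rule ccontr)
    assume "f x \<noteq> 0"
    with N(2)[OF that, of "\<bar>f x\<bar>"] obtain d where
      d: "d > 0" "\<And>h. 0 < h \<Longrightarrow> h < d \<Longrightarrow>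
         norm (integral (cbox x (x + h *\<^sub>R One)) f /\<^sub>R h ^ DIM('a) - f x) < \<bar>f x\<bar>"
      by auto
    have "integral (cbox x (x + (d/2) *\<^sub>R One)) f = 0"
      using assms by (blast intro: integral_unique)
    with d(2)[of "d/2"] d(1) show False by simp
  qed
  moreover have "N \<in> null_sets lebesgue"
    using N(1) by (simp add: negligible_iff_null_sets)
  ultimately show ?thesis
    by (auto intro: AE_I')
qed

text \<open>Testing with \<open>box_bump\<close> and letting k grow gives, by dominated convergence,
  integral 0 over every closed box inside \<Omega>. Lebesgue differentiation makes g vanish almost
  everywhere on each such box, and countably many of them cover \<Omega>.\<close>

lemma fundamental_lemma_calculus_of_variations:
  fixes g :: "real ^ 'n::finite \<Rightarrow> real"
  assumes "open \<Omega>" and g: "locally_integrable_on g \<Omega>"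
    and test: "\<And>\<psi>. \<psi> \<in> test_functions \<Omega> \<Longrightarrow> (LINT x:\<Omega>|lebesgue. g x * \<psi> x) = 0"
  shows "AE x\<in>\<Omega> in lebesgue. g x = 0"
proof -
  have cbox0: "(LINT x:cbox c d|lebesgue. g x) = 0" if sub: "cbox c d \<subseteq> \<Omega>" for c d
  proof -
    have int: "set_integrable lebesgue (cbox c d) g"
      using g sub by (auto simp: locally_integrable_on_def)
    have "(\<lambda>k. LINT x:cbox c d|lebesgue. g x * box_bump c d k x) \<longlonglongrightarrow>
        (LINT x|lebesgue. indicator (box c d) x *\<^sub>R g x)"
      unfolding set_lebesgue_integral_def
    proof (rule integral_dominated_convergence)
      show "integrable lebesgue (\<lambda>x. norm (indicator (cbox c d) x *\<^sub>R g x))"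
        using int unfolding set_integrable_def by (rule integrable_norm)
      have [measurable]: "(\<lambda>x. indicator (cbox c d) x *\<^sub>R g x) \<in> borel_measurable lebesgue"
        using int unfolding set_integrable_def by auto
      have "(\<lambda>x. indicator (box c d) x *\<^sub>R (indicator (cbox c d) x *\<^sub>R g x)) \<in> borel_measurable lebesgue"
        by (rule borel_measurable_scaleR[OF borel_measurable_indicator]) (simp, measurable)
      also have "(\<lambda>x. indicator (box c d) x *\<^sub>R (indicator (cbox c d) x *\<^sub>R g x)) =
          (\<lambda>x. indicator (box c d) x *\<^sub>R g x)"
        using box_subset_cbox by (auto simp: indicator_def fun_eq_iff)
      finally show "(\<lambda>x. indicator (box c d) x *\<^sub>R g x) \<in> borel_measurable lebesgue" .
      have cont: "continuous_on UNIV (box_bump c d k)" for k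
        using smooth_box_bump[of c d k] unfolding smooth_def
        by (metis continuous_at_imp_continuous_on differentiable_imp_continuous_within foldr.simps(1) id_apply)
      have bm: "box_bump c d k \<in> borel_measurable lebesgue" for k
        using borel_measurable_continuous_onI[OF cont] by (simp add: measurable_completion)
      have "(\<lambda>x. (indicator (cbox c d) x *\<^sub>R g x) * box_bump c d k x) \<in> borel_measurable lebesgue" for k
        using bm by (intro borel_measurable_times) measurable
      then show "(\<lambda>x. indicator (cbox c d) x *\<^sub>R (g x * box_bump c d k x)) \<in> borel_measurable lebesgue" for k
        by (simp add: mult.assoc)
      show "AE x in lebesgue. (\<lambda>k. indicator (cbox c d) x *\<^sub>R (g x * box_bump c d k x))
          \<longlonglongrightarrow> indicator (box c d) x *\<^sub>R g x"
      proof (intro AE_I2)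
        fix x :: "real^'n"
        have "(\<lambda>k. indicator (cbox c d) x *\<^sub>R (g x * box_bump c d k x)) \<longlonglongrightarrow>
            indicator (cbox c d) x *\<^sub>R (g x * indicator (box c d) x)"
          by (intro tendsto_intros box_bump_tendsto_indicator)
        also have "indicator (cbox c d) x *\<^sub>R (g x * indicator (box c d) x) = indicator (box c d) x *\<^sub>R g x"
          using box_subset_cbox by (auto simp: indicator_def)
        finally show "(\<lambda>k. indicator (cbox c d) x *\<^sub>R (g x * box_bump c d k x))
          \<longlonglongrightarrow> indicator (box c d) x *\<^sub>R g x" .
      qed
      show "AE x in lebesgue. norm (indicator (cbox c d) x *\<^sub>R (g x * box_bump c d k x))
          \<le> norm (indicator (cbox c d) x *\<^sub>R g x)" for k
        using box_bump_bounds[of c d k] by (auto simp: indicator_def abs_mult mult_left_le)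
    qed
    moreover have "(LINT x:cbox c d|lebesgue. g x * box_bump c d k x) =
        (LINT x:\<Omega>|lebesgue. g x * box_bump c d k x)" for k
      unfolding set_lebesgue_integral_def
      using sub box_bump_outside[of _ c d k] box_subset_cbox[of c d]
      by (intro Bochner_Integration.integral_cong) (auto simp: indicator_def)
    \<comment> \<open>The bumps converge to the open box only; its faces form a null set.\<close>
    moreover have "(LINT x|lebesgue. indicator (box c d) x *\<^sub>R g x) = (LINT x:cbox c d|lebesgue. g x)"
      unfolding set_lebesgue_integral_def
    proof (rule integral_cong_AE)
      have "cbox c d - box c d \<in> null_sets lebesgue"
        using negligible_frontier_interval by (simp add: negligible_iff_null_sets)
      then have "AE x in lebesgue. x \<notin> cbox c d - box c d"
        by (rule AE_not_in)
      then show "AE x in lebesgue. indicator (box c d) x *\<^sub>R g x = indicator (cbox c d) x *\<^sub>R g x"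
        by eventually_elim (use box_subset_cbox in \<open>auto simp: indicator_def\<close>)
      show "(\<lambda>x. indicator (box c d) x *\<^sub>R g x) \<in> borel_measurable lebesgue"
        using set_integrable_subset[OF int _ box_subset_cbox] unfolding set_integrable_def
        by (rule borel_measurable_integrable) simp
      show "(\<lambda>x. indicator (cbox c d) x *\<^sub>R g x) \<in> borel_measurable lebesgue"
        using int unfolding set_integrable_def by (rule borel_measurable_integrable)
    qed
    ultimately have "(\<lambda>k::nat. 0) \<longlonglongrightarrow> (LINT x:cbox c d|lebesgue. g x)"
      by (simp only: test[OF box_bump_in_test_functions[OF sub]])
    then show ?thesis
      by (simp add: LIMSEQ_const_iff)
  qed
  \<comment> \<open>The differentiation lemma wants all boxes, including those that leave \<Omega>.
    Cutting g off outside \<open>cbox c d\<close> reduces any box to its intersection with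
    \<open>cbox c d\<close>, which is again a box inside \<Omega>.\<close>
  have ae: "AE x\<in>cbox c d in lebesgue. g x = 0" if sub: "cbox c d \<subseteq> \<Omega>" for c d
  proof -
    have "((\<lambda>x. indicator (cbox c d) x *\<^sub>R g x) has_integral 0) (cbox c' d')" for c' d'
    proof -
      obtain p q where pq: "cbox c' d' \<inter> cbox c d = cbox p q"
        by (rule that[OF Int_interval])
      then have sub': "cbox p q \<subseteq> \<Omega>" using sub by auto
      then have "set_integrable lebesgue (cbox p q) g"
        using g by (auto simp: locally_integrable_on_def)
      then have "(g has_integral (LINT x:cbox p q|lebesgue. g x)) (cbox p q)"
        by (rule has_integral_set_lebesgue)
      then have "(g has_integral 0) (cbox p q)"
        using cbox0[OF sub'] by simp
      then have "((\<lambda>x. if x \<in> cbox c d then g x else 0) has_integral 0) (cbox c' d')"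
        using pq by (subst has_integral_restrict_Int) (simp add: Int_commute)
      then show ?thesis
        by (rule has_integral_eq[rotated]) (auto simp: indicator_def)
    qed
    from AE_eq_0_if_integral_cbox_eq_0[OF this] show ?thesis
      by eventually_elim (auto simp: indicator_def)
  qed
  \<comment> \<open>Exceptional null sets can be united only countably often, hence a countable
    cover of \<Omega> by closed boxes.\<close>
  obtain D where D: "countable D" "D \<subseteq> Pow \<Omega>" "\<And>X. X \<in> D \<Longrightarrow> \<exists>c d. X = cbox c d" "\<Union>D = \<Omega>"
    by (rule open_countable_Union_open_cbox[OF \<open>open \<Omega>\<close>]) (rule that)
  have "AE x in lebesgue. x \<in> X \<longrightarrow> g x = 0" if "X \<in> D" for X
    using ae D(2) D(3)[OF that] that by auto
  then have "AE x in lebesgue. \<forall>X\<in>D. x \<in> X \<longrightarrow> g x = 0"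
    using D(1) by (rule AE_ball_countable')
  then show ?thesis
    by eventually_elim (use D(4) in auto)
qed

section \<open>Weak partial derivatives\<close>

lemma smooth_differentiable: "smooth f \<Longrightarrow> f differentiable (at x)"
  unfolding smooth_def by (metis foldr.simps(1) id_apply)

lemma smooth_partial: "smooth f \<Longrightarrow> smooth (partial i f)"
  unfolding smooth_def
proof (intro allI)
  fix "is" x assume "\<forall>is x. foldr partial is f differentiable (at x)"
  then have "foldr partial (is @ [i]) f differentiable (at x)" by blast
  then show "foldr partial is (partial i f) differentiable (at x)" by simp
qed

lemma smooth_continuous_on: "smooth f \<Longrightarrow> continuous_on S f"
  by (intro continuous_at_imp_continuous_on ballI differentiable_imp_continuous_within
      smooth_differentiable)

lemma has_derivative_partial:
  fixes f :: "real ^ 'n::finite \<Rightarrow> real"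
  assumes "f differentiable (at x)"
  shows "(f has_derivative (\<lambda>h. \<Sum>i\<in>UNIV. h $ i * partial i f x)) (at x)"
proof -
  have d: "(f has_derivative frechet_derivative f (at x)) (at x)"
    using assms by (simp add: frechet_derivative_works)
  have "frechet_derivative f (at x) h = (\<Sum>i\<in>UNIV. h $ i * partial i f x)" for h
  proof -
    have lin: "linear (frechet_derivative f (at x))"
      using d by (rule has_derivative_linear)
    have "frechet_derivative f (at x) h = frechet_derivative f (at x) (\<Sum>i\<in>UNIV. h $ i *\<^sub>R axis i 1)"
      by (simp add: basis_expansion scalar_mult_eq_scaleR[symmetric])
    also have "\<dots> = (\<Sum>i\<in>UNIV. h $ i * partial i f x)"
      by (simp add: linear_sum[OF lin] linear_cmul[OF lin] partial_def)
    finally show ?thesis .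
  qed
  then show ?thesis
    using d by (rule has_derivative_eq_rhs[rotated, OF ext])
qed

lemma partial_eqI:
  "(f has_derivative f') (at x) \<Longrightarrow> partial i f x = f' (axis i 1)"
  unfolding partial_def by (metis frechet_derivative_at)

lemma has_real_derivative_along:
  assumes "f differentiable (at (x + s *\<^sub>R axis i 1))"
  shows "((\<lambda>t. f (x + t *\<^sub>R axis i 1)) has_real_derivative partial i f (x + s *\<^sub>R axis i 1)) (at s)"
proof -
  let ?D = "frechet_derivative f (at (x + s *\<^sub>R axis i 1))"
  have "((\<lambda>t. f (x + t *\<^sub>R axis i 1)) has_derivative (\<lambda>t. ?D (t *\<^sub>R axis i 1))) (at s)"
  proof (rule has_derivative_compose[where f="\<lambda>t. x + t *\<^sub>R axis i 1"])
    show "((\<lambda>t. x + t *\<^sub>R axis i 1) has_derivative (\<lambda>t. t *\<^sub>R axis i 1)) (at s)"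
      by (auto intro!: derivative_eq_intros)
    show "(f has_derivative ?D) (at (x + s *\<^sub>R axis i 1))"
      using assms by (simp add: frechet_derivative_works)
  qed
  moreover have "linear ?D"
    by (rule linear_frechet_derivative[OF assms])
  ultimately show ?thesis
    by (simp add: has_field_derivative_def partial_def linear_cmul mult_commute_abs)
qed

lemma partial_zero_outside:
  assumes "\<And>x. x \<notin> K \<Longrightarrow> f x = 0" "closed K" "x \<notin> K"
  shows "partial i f x = 0"
proof -
  have "((\<lambda>x. 0) has_derivative (\<lambda>h. 0)) (at x)" by simp
  then have "(f has_derivative (\<lambda>h. 0)) (at x)"
    by (rule has_derivative_transform_within_open[OF _ open_Compl[OF assms(2)]])
       (use assms in auto)
  from partial_eqI[OF this] show ?thesis .
qed

lemma test_functions_partial: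
  assumes "\<phi> \<in> test_functions \<Omega>" shows "partial i \<phi> \<in> test_functions \<Omega>"
proof -
  let ?K = "closure {x. \<phi> x \<noteq> 0}"
  from assms have \<phi>: "smooth \<phi>" "compact ?K" "?K \<subseteq> \<Omega>"
    by (auto simp: test_functions_def)
  have "partial i \<phi> x = 0" if "x \<notin> ?K" for x
  proof (rule partial_zero_outside)
    show "\<phi> y = 0" if "y \<notin> ?K" for y
      using that closure_subset[of "{x. \<phi> x \<noteq> 0}"] by auto
    show "closed ?K" by simp
  qed (rule that)
  then have sub: "closure {x. partial i \<phi> x \<noteq> 0} \<subseteq> ?K"
    by (intro closure_minimal) auto
  then have "compact (closure {x. partial i \<phi> x \<noteq> 0})"
    using compact_Int_closed[OF \<phi>(2), of "closure {x. partial i \<phi> x \<noteq> 0}"]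
    by (simp only: Int_absorb1 closed_closure)
  with \<phi> sub show ?thesis
    by (auto simp: test_functions_def smooth_partial)
qed

lemma test_functionsE:
  assumes "\<phi> \<in> test_functions \<Omega>"
  obtains K where "compact K" "K \<subseteq> \<Omega>" "\<And>x. x \<notin> K \<Longrightarrow> \<phi> x = 0" "smooth \<phi>"
proof
  show "\<phi> x = 0" if "x \<notin> closure {x. \<phi> x \<noteq> 0}" for x
    using that closure_subset[of "{x. \<phi> x \<noteq> 0}"] by auto
qed (use assms in \<open>auto simp: test_functions_def\<close>)

section \<open>Integration by parts with compact support\<close>

lemma integrable_continuous_on_compact_support:
  fixes f :: "'a::euclidean_space \<Rightarrow> real"
  assumes "compact K" "continuous_on K f" "\<And>x. x \<notin> K \<Longrightarrow> f x = 0"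
  shows "integrable lborel f" "integrable lebesgue f"
proof -
  have "integrable lborel (\<lambda>x. indicator K x *\<^sub>R f x)"
    using assms by (intro borel_integrable_compact) auto
  also have "(\<lambda>x. indicator K x *\<^sub>R f x) = f"
    using assms(3) by (auto simp: indicator_def fun_eq_iff)
  finally show *: "integrable lborel f" .
  then show "integrable lebesgue f"
    by (simp add: integrable_completion)
qed

text \<open>Translation invariance makes each difference quotient of F along e integrate to 0. The
  quotients converge pointwise to G under a common integrable bound, so the integral of G is 0 as
  well.\<close>

lemma integral_directional_derivative_eq_0:
  fixes F G :: "'a::euclidean_space \<Rightarrow> real"
  assumes K: "compact K" "continuous_on UNIV F" "\<And>x. x \<notin> K \<Longrightarrow> F x = 0"
    and deriv: "\<And>x. ((\<lambda>t. F (x + t *\<^sub>R e)) has_real_derivative G x) (at 0)"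
    and bound: "\<And>x. \<bar>G x\<bar> \<le> B"
  shows "integrable lebesgue G" "(LINT x|lebesgue. G x) = 0"
proof -
  have deriv': "((\<lambda>t. F (x + t *\<^sub>R e)) has_real_derivative G (x + s *\<^sub>R e)) (at s)" for x s
    using DERIV_shift[of "\<lambda>t. F (x + t *\<^sub>R e)" "G (x + s *\<^sub>R e)" 0 s]
      deriv[of "x + s *\<^sub>R e"] by (simp add: scaleR_add_left add.assoc add.commute add.left_commute)
  \<comment> \<open>By the mean value theorem the bound on G is a Lipschitz bound along e, so the
    quotients are bounded by B.\<close>
  have lip: "\<bar>F (x + t *\<^sub>R e) - F x\<bar> \<le> B * t" if "t > 0" for x t
  proof -
    obtain z where "F (x + t *\<^sub>R e) - F (x + 0 *\<^sub>R e) = (t - 0) * G (x + z *\<^sub>R e)"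
      using MVT2[OF \<open>t > 0\<close>, of "\<lambda>t. F (x + t *\<^sub>R e)" "\<lambda>s. G (x + s *\<^sub>R e)"] deriv' by blast
    then show ?thesis
      using bound[of "x + z *\<^sub>R e"] that by (simp add: abs_mult mult.commute)
  qed
  have B: "0 \<le> B" using bound[of 0] by linarith
  obtain r where r: "\<And>x. x \<in> K \<Longrightarrow> norm x \<le> r"
    using compact_imp_bounded[OF K(1)] by (auto simp: bounded_iff)
  define t where "t n = inverse (real (Suc n))" for n
  have t: "0 < t n" "t n \<le> 1" for n
    by (auto simp: t_def inverse_le_1_iff)
  have t0: "filterlim t (at 0) sequentially"
    unfolding t_def filterlim_at using LIMSEQ_inverse_real_of_nat by auto
  let ?s = "\<lambda>n x. (F (x + t n *\<^sub>R e) - F x) / t n"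
  have [measurable]: "F \<in> borel_measurable borel"
    using K(2) by (rule borel_measurable_continuous_onI)
  have lim: "(\<lambda>n. ?s n x) \<longlonglongrightarrow> G x" for x
  proof -
    have "((\<lambda>h. (F (x + h *\<^sub>R e) - F x) / h) \<longlongrightarrow> G x) (at 0)"
      using deriv[of x] by (simp add: has_field_derivative_iff)
    from filterlim_compose[OF this t0] show ?thesis .
  qed
  \<comment> \<open>The increments satisfy 0 < t n \<le> 1, so all quotients vanish outside the ball
    of radius r + |e|.\<close>
  have dom: "integrable lborel (\<lambda>x. B * indicator (cball 0 (r + norm e)) x)"
    using emeasure_bounded_finite[OF bounded_cball, of 0 "r + norm e"]
    by (intro integrable_mult_right integrable_real_indicator) auto
  have sdom: "norm (?s n x) \<le> B * indicator (cball 0 (r + norm e)) x" for n x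
  proof (cases "x \<in> cball 0 (r + norm e)")
    case True
    then show ?thesis
      using lip[OF t(1)[of n], of x] t(1)[of n] by (simp add: field_simps)
  next
    case False
    have "norm (t n *\<^sub>R e) \<le> norm e"
      using t[of n] by (simp add: mult_left_le_one_le)
    then have "norm (x + t n *\<^sub>R e) > r" "norm x > r"
      using False norm_diff_ineq[of x "t n *\<^sub>R e"] norm_ge_zero[of e] unfolding mem_cball_0 by linarith+
    then have "F (x + t n *\<^sub>R e) = 0" "F x = 0"
      using r K(3) by (meson not_le)+
    then show ?thesis using B by simp
  qed
  have G[measurable]: "G \<in> borel_measurable lborel"
    by (rule borel_measurable_LIMSEQ_real[OF lim]) measurable
  have s: "?s n \<in> borel_measurable lborel" for n
    by measurable
  have "integrable lborel G"
    using integrable_dominated_convergence[OF G s dom AE_I2[OF lim] AE_I2[OF sdom]] .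
  then show "integrable lebesgue G"
    by (simp add: integrable_completion)
  have "(\<lambda>n. LINT x|lborel. ?s n x) \<longlonglongrightarrow> (LINT x|lborel. G x)"
    using integral_dominated_convergence[OF G s dom AE_I2[OF lim] AE_I2[OF sdom]] .
  moreover have "(LINT x|lborel. ?s n x) = 0" for n
  proof -
    have F: "integrable lborel F"
      using integrable_continuous_on_compact_support(1)[OF K(1) continuous_on_subset[OF K(2) subset_UNIV] K(3)] .
    have eq: "lborel = distr lborel borel (\<lambda>x. t n *\<^sub>R e + x)"
      by (rule lborel_distr_plus[symmetric])
    have "integrable lborel (\<lambda>x. F (t n *\<^sub>R e + x))"
      using F by (subst (asm) eq) (simp add: integrable_distr_eq)
    moreover have "(LINT x|lborel. F x) = (LINT x|lborel. F (t n *\<^sub>R e + x))"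
      by (subst eq) (simp add: integral_distr)
    ultimately show ?thesis
      using F by (simp add: add.commute)
  qed
  ultimately have "(\<lambda>n::nat. 0) \<longlonglongrightarrow> (LINT x|lborel. G x)"
    by (simp only:)
  then have "(LINT x|lborel. G x) = 0"
    by (simp add: LIMSEQ_const_iff)
  then show "(LINT x|lebesgue. G x) = 0"
    by (simp add: integral_completion)
qed

lemma set_integrable_mult_test_function:
  assumes "locally_integrable_on u \<Omega>" "\<psi> \<in> test_functions \<Omega>"
  shows "set_integrable lebesgue \<Omega> (\<lambda>x. u x * \<psi> x)"
proof -
  from assms(2) obtain K where K: "compact K" "K \<subseteq> \<Omega>" "\<And>x. x \<notin> K \<Longrightarrow> \<psi> x = 0" "smooth \<psi>"
    by (rule test_functionsE) blast
  have u: "integrable lebesgue (\<lambda>x. indicator K x *\<^sub>R u x)"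
    using assms(1) K by (auto simp: locally_integrable_on_def set_integrable_def)
  have "continuous_on K \<psi>" using K(4) by (rule smooth_continuous_on)
  then have "bounded (\<psi> ` K)"
    using K(1) by (intro compact_imp_bounded compact_continuous_image)
  then obtain B where B: "\<And>x. x \<in> K \<Longrightarrow> \<bar>\<psi> x\<bar> \<le> B"
    by (auto simp: bounded_iff)
  have "\<psi> \<in> borel_measurable lebesgue"
    using borel_measurable_continuous_onI[OF smooth_continuous_on[OF K(4)]]
    by (simp add: measurable_completion)
  then have "integrable lebesgue (\<lambda>x. (indicator K x *\<^sub>R u x) * \<psi> x)"
  proof (intro Bochner_Integration.integrable_bound[OF integrable_mult_right[OF integrable_norm[OF u], of "\<bar>B\<bar>"]])
    show "AE x in lebesgue. norm ((indicator K x *\<^sub>R u x) * \<psi> x) \<le> norm (\<bar>B\<bar> * norm (indicator K x *\<^sub>R u x))"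
    proof (intro AE_I2)
      fix x
      show "norm ((indicator K x *\<^sub>R u x) * \<psi> x) \<le> norm (\<bar>B\<bar> * norm (indicator K x *\<^sub>R u x))"
      proof (cases "x \<in> K")
        case True
        then have "\<bar>\<psi> x\<bar> \<le> \<bar>B\<bar>" using B[of x] by linarith
        then show ?thesis
          using mult_right_mono[of "\<bar>\<psi> x\<bar>" "\<bar>B\<bar>" "\<bar>u x\<bar>"] True by (simp add: abs_mult mult.commute)
      qed simp
    qed
  qed (use u in \<open>auto intro!: borel_measurable_times\<close>)
  also have "(\<lambda>x. (indicator K x *\<^sub>R u x) * \<psi> x) = (\<lambda>x. indicator \<Omega> x *\<^sub>R (u x * \<psi> x))"
    using K by (auto simp: indicator_def fun_eq_iff)
  finally show ?thesis by (simp add: set_integrable_def)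
qed

lemma locally_integrable_on_continuous:
  "continuous_on UNIV f \<Longrightarrow> locally_integrable_on f \<Omega>"
  unfolding locally_integrable_on_def set_integrable_def
proof (intro allI impI)
  fix K assume "continuous_on UNIV f" "compact K \<and> K \<subseteq> \<Omega>"
  then have "integrable lborel (\<lambda>x. indicator K x *\<^sub>R f x)"
    by (intro borel_integrable_compact) (auto intro: continuous_on_subset)
  then show "integrable lebesgue (\<lambda>x. indicator K x *\<^sub>R f x)"
    by (simp add: integrable_completion)
qed

text \<open>By the product rule the sum of the two integrands is the derivative of u * \<phi> along
  a coordinate axis, and u * \<phi> has compact support. The lemma makes the classical partials of a
  test function available as weak ones.\<close>

lemma has_weak_partial_smooth:
  assumes u: "smooth u" shows "has_weak_partial \<Omega> i u (partial i u)"
  unfolding has_weak_partial_def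
proof (intro conjI ballI)
  show "locally_integrable_on u \<Omega>" "locally_integrable_on (partial i u) \<Omega>"
    using u by (auto intro!: locally_integrable_on_continuous smooth_continuous_on smooth_partial)
  fix \<phi> assume \<phi>: "\<phi> \<in> test_functions \<Omega>"
  then obtain K where K: "compact K" "K \<subseteq> \<Omega>" "\<And>x. x \<notin> K \<Longrightarrow> \<phi> x = 0" "smooth \<phi>"
    by (rule test_functionsE) blast
  have z: "partial i \<phi> x = 0" if "x \<notin> K" for x
    using K that by (intro partial_zero_outside[of K]) (auto simp: compact_imp_closed)
  let ?G = "\<lambda>x. u x * partial i \<phi> x + partial i u x * \<phi> x"
  have cont: "continuous_on S (\<lambda>x. u x * partial i \<phi> x)" "continuous_on S (\<lambda>x. partial i u x * \<phi> x)" for S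
    by (intro continuous_on_mult smooth_continuous_on smooth_partial u K(4))+
  have int: "integrable lebesgue (\<lambda>x. u x * partial i \<phi> x)" "integrable lebesgue (\<lambda>x. partial i u x * \<phi> x)"
    using K(3) z by (auto intro!: integrable_continuous_on_compact_support[OF K(1)] cont)
  have "bounded (?G ` K)"
    using K(1) by (intro compact_imp_bounded compact_continuous_image continuous_on_add cont)
  then obtain B where B: "\<And>x. x \<in> K \<Longrightarrow> \<bar>?G x\<bar> \<le> B"
    by (auto simp: bounded_iff)
  have "(LINT x|lebesgue. ?G x) = 0"
  proof (rule integral_directional_derivative_eq_0[OF K(1), where F="\<lambda>x. u x * \<phi> x" and B="max B 0" and e="axis i 1"])
    show "continuous_on UNIV (\<lambda>x. u x * \<phi> x)"
      using u K(4) by (intro continuous_on_mult smooth_continuous_on)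
    show "\<bar>?G x\<bar> \<le> max B 0" for x
      using B[of x] K(3)[of x] z[of x] by (cases "x \<in> K") auto
    fix x
    have line: "((\<lambda>t. f (x + t *\<^sub>R axis i 1)) has_real_derivative partial i f x) (at 0)" if "smooth f" for f
      using has_real_derivative_along[of f x 0 i] smooth_differentiable[OF that] by simp
    from DERIV_mult[OF line[OF u] line[OF K(4)]]
    show "((\<lambda>t. u (x + t *\<^sub>R axis i 1) * \<phi> (x + t *\<^sub>R axis i 1)) has_real_derivative ?G x) (at 0)"
      by (simp add: algebra_simps)
  qed (use K(3) in auto)
  then have "(LINT x|lebesgue. u x * partial i \<phi> x) = - (LINT x|lebesgue. partial i u x * \<phi> x)"
    using int by simp
  moreover have "(LINT x:\<Omega>|lebesgue. u x * partial i \<phi> x) = (LINT x|lebesgue. u x * partial i \<phi> x)"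
    "(LINT x:\<Omega>|lebesgue. partial i u x * \<phi> x) = (LINT x|lebesgue. partial i u x * \<phi> x)"
    unfolding set_lebesgue_integral_def using subsetD[OF K(2)] K(3) z
    by (intro Bochner_Integration.integral_cong refl; fastforce simp: indicator_def)+
  ultimately show "(LINT x:\<Omega>|lebesgue. u x * partial i \<phi> x) = - (LINT x:\<Omega>|lebesgue. partial i u x * \<phi> x)"
    by simp
qed

section \<open>Uniqueness of weak partial derivatives\<close>

lemma locally_integrable_on_diff:
  "locally_integrable_on f \<Omega> \<Longrightarrow> locally_integrable_on g \<Omega> \<Longrightarrow> locally_integrable_on (\<lambda>x. f x - g x) \<Omega>"
  unfolding locally_integrable_on_def by (auto intro: set_integral_diff)

lemma has_weak_partial_diff:
  assumes "has_weak_partial \<Omega> i u v" "has_weak_partial \<Omega> i u' v'"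
  shows "has_weak_partial \<Omega> i (\<lambda>x. u x - u' x) (\<lambda>x. v x - v' x)"
  using assms unfolding has_weak_partial_def
  by (auto simp: locally_integrable_on_diff left_diff_distrib set_integral_diff
      set_integrable_mult_test_function test_functions_partial)

text \<open>The difference of the two candidates is a weak partial of u - u = 0, hence integrates to
  0 against every test function.\<close>

lemma has_weak_partial_unique:
  assumes "open \<Omega>" "has_weak_partial \<Omega> i u v" "has_weak_partial \<Omega> i u v'"
  shows "AE x\<in>\<Omega> in lebesgue. v x = v' x"
proof -
  have "has_weak_partial \<Omega> i (\<lambda>x. u x - u x) (\<lambda>x. v x - v' x)"
    by (rule has_weak_partial_diff) (use assms in auto)
  then have "AE x\<in>\<Omega> in lebesgue. v x - v' x = 0"
    using assms(1) by (intro fundamental_lemma_calculus_of_variations)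
      (auto simp: has_weak_partial_def)
  then show ?thesis by simp
qed

lemma has_weak_partial_weak_partial:
  "has_weak_partial \<Omega> i u v \<Longrightarrow> has_weak_partial \<Omega> i u (weak_partial \<Omega> i u)"
  unfolding weak_partial_def by (rule someI[where P="has_weak_partial \<Omega> i u"])

lemma weak_partial_AE_eq:
  assumes "open \<Omega>" "has_weak_partial \<Omega> i u v"
  shows "AE x\<in>\<Omega> in lebesgue. weak_partial \<Omega> i u x = v x"
  by (rule has_weak_partial_unique[OF assms(1) has_weak_partial_weak_partial[OF assms(2)] assms(2)])

text \<open>The preimages of a set under f and g differ only inside a null set, and a completed
  measure makes subsets of null sets measurable. Representatives chosen as weak derivatives are
  known only up to null sets, so their measurability is obtained this way.\<close>

lemma borel_measurable_completion_cong_AE: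
  assumes f: "f \<in> borel_measurable (completion M)" and ae: "AE x in completion M. f x = g x"
  shows "g \<in> borel_measurable (completion M)"
proof (rule measurableI)
  fix A :: "'b set" assume "A \<in> sets borel"
  then have "f -` A \<inter> space (completion M) \<in> sets (completion M)"
    using f by (rule measurable_sets[rotated])
  then show "g -` A \<inter> space (completion M) \<in> sets (completion M)"
  proof (rule completion.in_sets_AE[rotated])
    show "AE x in completion M. x \<in> f -` A \<inter> space (completion M) \<longleftrightarrow> x \<in> g -` A \<inter> space (completion M)"
      using ae by eventually_elim auto
  qed simp
qed simp

text \<open>Needed for second derivatives: \<open>weak_partial\<close> is applied to a chosen first
  derivative, which agrees with an explicit one only almost everywhere.\<close>

lemma has_weak_partial_cong_AE:
  assumes "open \<Omega>" and u: "AE x\<in>\<Omega> in lebesgue. u x = u' x" and "has_weak_partial \<Omega> i u v"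
  shows "has_weak_partial \<Omega> i u' v"
proof -
  have "locally_integrable_on u' \<Omega>"
    unfolding locally_integrable_on_def
  proof (intro allI impI)
    fix K assume K: "compact K \<and> K \<subseteq> \<Omega>"
    then have "integrable lebesgue (\<lambda>x. indicator K x *\<^sub>R u x)"
      using assms(3) by (auto simp: has_weak_partial_def locally_integrable_on_def set_integrable_def)
    moreover have ae: "AE x in lebesgue. indicator K x *\<^sub>R u x = indicator K x *\<^sub>R u' x"
      using u by eventually_elim (use K in \<open>auto simp: indicator_def\<close>)
    moreover from this have "(\<lambda>x. indicator K x *\<^sub>R u' x) \<in> borel_measurable lebesgue"
      by (rule borel_measurable_completion_cong_AE[rotated]) (use calculation(1) in auto)
    ultimately show "set_integrable lebesgue K u'"
      unfolding set_integrable_def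
      using integrable_cong_AE_imp[of lebesgue "\<lambda>x. indicator K x *\<^sub>R u x" "\<lambda>x. indicator K x *\<^sub>R u' x"]
      by (simp only:)
  qed
  moreover have "(LINT x:\<Omega>|lebesgue. u' x * \<psi> x) = (LINT x:\<Omega>|lebesgue. u x * \<psi> x)"
    if "\<psi> \<in> test_functions \<Omega>" for \<psi>
    unfolding set_lebesgue_integral_def
  proof (rule integral_cong_AE)
    show "AE x in lebesgue. indicator \<Omega> x *\<^sub>R (u' x * \<psi> x) = indicator \<Omega> x *\<^sub>R (u x * \<psi> x)"
      using u by eventually_elim (auto simp: indicator_def)
    show "(\<lambda>x. indicator \<Omega> x *\<^sub>R (u' x * \<psi> x)) \<in> borel_measurable lebesgue"
      using set_integrable_mult_test_function[OF \<open>locally_integrable_on u' \<Omega>\<close> that]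
      by (auto simp: set_integrable_def)
    show "(\<lambda>x. indicator \<Omega> x *\<^sub>R (u x * \<psi> x)) \<in> borel_measurable lebesgue"
      using set_integrable_mult_test_function[OF _ that, of u] assms(3)
      by (auto simp: set_integrable_def has_weak_partial_def)
  qed
  ultimately show ?thesis
    using assms(3) by (auto simp: has_weak_partial_def test_functions_partial)
qed

text \<open>Both iterated partial derivatives are values, at points near \<open>x\<close>, of the second
  difference quotient of \<open>f\<close> over a small square.\<close>

lemma partial_commute:
  fixes f :: "real ^ 'n::finite \<Rightarrow> real"
  assumes f: "smooth f"
  shows "partial i (partial j f) x = partial j (partial i f) x"
proof -
  let ?e = "\<lambda>k::'n. axis k (1::real)"
  define Q where "Q h = f (x + h *\<^sub>R ?e i + h *\<^sub>R ?e j) - f (x + h *\<^sub>R ?e i) - f (x + h *\<^sub>R ?e j) + f x" for h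
  have Q_sym: "Q h = f (x + h *\<^sub>R ?e j + h *\<^sub>R ?e i) - f (x + h *\<^sub>R ?e j) - f (x + h *\<^sub>R ?e i) + f x" for h
    by (simp add: Q_def add_ac)
  have diff: "g differentiable (at y)" if "smooth g" for g :: "real ^ 'n \<Rightarrow> real" and y
    using that by (rule smooth_differentiable)
  have second_difference: "\<exists>a b. 0 < a \<and> a < h \<and> 0 < b \<and> b < h \<and>
      f (x + h *\<^sub>R ?e k + h *\<^sub>R ?e l) - f (x + h *\<^sub>R ?e k) - f (x + h *\<^sub>R ?e l) + f x =
        h * h * partial l (partial k f) (x + a *\<^sub>R ?e k + b *\<^sub>R ?e l)" if h: "h > 0" for h k l
  proof -
    \<comment> \<open>Mean value theorem twice: first in direction k for the increment of f in
      direction l, then in direction l for \<open>partial k f\<close>.\<close>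
    let ?g = "\<lambda>t. f (x + h *\<^sub>R ?e l + t *\<^sub>R ?e k) - f (x + t *\<^sub>R ?e k)"
    have "(?g has_real_derivative (partial k f (x + h *\<^sub>R ?e l + t *\<^sub>R ?e k) - partial k f (x + t *\<^sub>R ?e k))) (at t)" for t
      by (intro DERIV_diff has_real_derivative_along diff f)
    then obtain a where a: "0 < a" "a < h"
      "?g h - ?g 0 = h * (partial k f (x + h *\<^sub>R ?e l + a *\<^sub>R ?e k) - partial k f (x + a *\<^sub>R ?e k))"
      using MVT2[OF h, of ?g "\<lambda>t. partial k f (x + h *\<^sub>R ?e l + t *\<^sub>R ?e k) - partial k f (x + t *\<^sub>R ?e k)"] by auto
    let ?g' = "\<lambda>t. partial k f (x + a *\<^sub>R ?e k + t *\<^sub>R ?e l)"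
    have "(?g' has_real_derivative (partial l (partial k f) (x + a *\<^sub>R ?e k + t *\<^sub>R ?e l))) (at t)" for t
      by (intro has_real_derivative_along diff smooth_partial f)
    then obtain b where b: "0 < b" "b < h"
      "?g' h - ?g' 0 = h * partial l (partial k f) (x + a *\<^sub>R ?e k + b *\<^sub>R ?e l)"
      using MVT2[OF h, of ?g' "\<lambda>t. partial l (partial k f) (x + a *\<^sub>R ?e k + t *\<^sub>R ?e l)"] by auto
    show ?thesis
      using a b by (intro exI[of _ a] exI[of _ b]) (simp add: add_ac mult.assoc)
  qed
  have lim: "(\<lambda>n. partial l (partial k f) (x + a n *\<^sub>R ?e k + b n *\<^sub>R ?e l)) \<longlonglongrightarrow> partial l (partial k f) x"
    if "a \<longlonglongrightarrow> 0" "b \<longlonglongrightarrow> 0" for a b :: "nat \<Rightarrow> real" and k l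
  proof -
    have "isCont (partial l (partial k f)) x"
      by (intro differentiable_imp_continuous_within diff smooth_partial f)
    moreover have "(\<lambda>n. x + a n *\<^sub>R ?e k + b n *\<^sub>R ?e l) \<longlonglongrightarrow> x + 0 *\<^sub>R ?e k + 0 *\<^sub>R ?e l"
      by (intro tendsto_intros that)
    then have "(\<lambda>n. x + a n *\<^sub>R ?e k + b n *\<^sub>R ?e l) \<longlonglongrightarrow> x"
      by simp
    ultimately show ?thesis
      by (rule isCont_tendsto_compose)
  qed
  define h where "h n = inverse (real (Suc n))" for n
  have h: "h n > 0" for n by (simp add: h_def)
  have h0: "h \<longlonglongrightarrow> 0" unfolding h_def by (rule LIMSEQ_inverse_real_of_nat)
  obtain a b where ab: "\<And>n. 0 < a n \<and> a n < h n \<and> 0 < b n \<and> b n < h n \<and>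
      Q (h n) = h n * h n * partial j (partial i f) (x + a n *\<^sub>R ?e i + b n *\<^sub>R ?e j)"
    using second_difference[OF h, of _ i j] unfolding Q_def by metis
  obtain a' b' where ab': "\<And>n. 0 < a' n \<and> a' n < h n \<and> 0 < b' n \<and> b' n < h n \<and>
      Q (h n) = h n * h n * partial i (partial j f) (x + a' n *\<^sub>R ?e j + b' n *\<^sub>R ?e i)"
    using second_difference[OF h, of _ j i] unfolding Q_sym by metis
  have small: "c \<longlonglongrightarrow> 0" if "\<And>n. 0 < c n \<and> c n < h n" for c :: "nat \<Rightarrow> real"
    by (rule tendsto_sandwich[OF _ _ tendsto_const h0]) (use that in \<open>auto intro!: always_eventually less_imp_le\<close>)
  have "(\<lambda>n. partial j (partial i f) (x + a n *\<^sub>R ?e i + b n *\<^sub>R ?e j)) \<longlonglongrightarrow> partial j (partial i f) x"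
    using ab by (intro lim small) blast+
  moreover have "(\<lambda>n. partial i (partial j f) (x + a' n *\<^sub>R ?e j + b' n *\<^sub>R ?e i)) \<longlonglongrightarrow> partial i (partial j f) x"
    using ab' by (intro lim small) blast+
  \<comment> \<open>Both values equal Q (h n) / (h n)^2, so the two sequences coincide and share
    their limit.\<close>
  moreover have "partial i (partial j f) (x + a' n *\<^sub>R ?e j + b' n *\<^sub>R ?e i) =
      partial j (partial i f) (x + a n *\<^sub>R ?e i + b n *\<^sub>R ?e j)" for n
    using ab[of n] ab'[of n] h[of n] by (metis less_irrefl mult_left_cancel mult_pos_pos)
  ultimately show ?thesis
    by (simp only: LIMSEQ_unique)
qed

section \<open>Polar derivatives in the plane\<close>

text \<open>In polar coordinates \<open>fE\<close> is the derivative of \<open>f\<close> in \<open>log |x|\<close>, and \<open>fR\<close> the one in the angle.\<close>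

definition has_polar_derivs ::
  "(real ^ 2 \<Rightarrow> real) \<Rightarrow> (real ^ 2 \<Rightarrow> real) \<Rightarrow> (real ^ 2 \<Rightarrow> real) \<Rightarrow> bool" where
  "has_polar_derivs f fE fR \<longleftrightarrow>
     (\<forall>x. x \<noteq> 0 \<longrightarrow> (f has_derivative
        (\<lambda>h. (fE x * (x \<bullet> h) + fR x * (x $ 1 * h $ 2 - x $ 2 * h $ 1)) / (norm x)\<^sup>2)) (at x)) \<and>
     continuous_on (- {0}) fE \<and> continuous_on (- {0}) fR"

lemma inner_2: "(x::real^2) \<bullet> y = x $ 1 * y $ 1 + x $ 2 * y $ 2"
  by (simp add: inner_vec_def sum_2)

lemma norm_sq_2: "(norm (x::real^2))\<^sup>2 = (x $ 1)\<^sup>2 + (x $ 2)\<^sup>2"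
  unfolding power2_norm_eq_inner inner_2 by (simp add: power2_eq_square)

lemma has_polar_derivs_continuous: "has_polar_derivs f fE fR \<Longrightarrow> continuous_on (- {0}) f"
  unfolding has_polar_derivs_def
  by (intro continuous_at_imp_continuous_on ballI) (blast intro: has_derivative_continuous)

lemma has_polar_derivs_eq:
  "has_polar_derivs f fE fR \<Longrightarrow> (\<And>x. fE x = gE x) \<Longrightarrow> (\<And>x. fR x = gR x) \<Longrightarrow> has_polar_derivs f gE gR"
  using ext[of fE gE] ext[of fR gR] by simp

lemma has_polar_derivs_const: "has_polar_derivs (\<lambda>x. c) (\<lambda>x. 0) (\<lambda>x. 0)"
  by (auto simp: has_polar_derivs_def)

lemma has_polar_derivs_add:
  assumes "has_polar_derivs f fE fR" "has_polar_derivs g gE gR"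
  shows "has_polar_derivs (\<lambda>x. f x + g x) (\<lambda>x. fE x + gE x) (\<lambda>x. fR x + gR x)"
  unfolding has_polar_derivs_def
proof (intro conjI allI impI)
  fix x :: "real^2" assume "x \<noteq> 0"
  with assms show "((\<lambda>x. f x + g x) has_derivative (\<lambda>h. ((fE x + gE x) * (x \<bullet> h) +
      (fR x + gR x) * (x $ 1 * h $ 2 - x $ 2 * h $ 1)) / (norm x)\<^sup>2)) (at x)"
    by (auto simp: has_polar_derivs_def add_divide_distrib distrib_right
        intro!: derivative_eq_intros)
qed (use assms in \<open>auto simp: has_polar_derivs_def intro!: continuous_intros\<close>)

lemma has_polar_derivs_mult:
  assumes "has_polar_derivs f fE fR" "has_polar_derivs g gE gR"
  shows "has_polar_derivs (\<lambda>x. f x * g x) (\<lambda>x. fE x * g x + f x * gE x) (\<lambda>x. fR x * g x + f x * gR x)"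
  unfolding has_polar_derivs_def
proof (intro conjI allI impI)
  fix x :: "real^2" assume "x \<noteq> 0"
  with assms have
    "(f has_derivative (\<lambda>h. (fE x * (x \<bullet> h) + fR x * (x $ 1 * h $ 2 - x $ 2 * h $ 1)) / (norm x)\<^sup>2)) (at x)"
    "(g has_derivative (\<lambda>h. (gE x * (x \<bullet> h) + gR x * (x $ 1 * h $ 2 - x $ 2 * h $ 1)) / (norm x)\<^sup>2)) (at x)"
    by (auto simp: has_polar_derivs_def)
  from has_derivative_mult[OF this]
  show "((\<lambda>x. f x * g x) has_derivative (\<lambda>h. ((fE x * g x + f x * gE x) * (x \<bullet> h) +
      (fR x * g x + f x * gR x) * (x $ 1 * h $ 2 - x $ 2 * h $ 1)) / (norm x)\<^sup>2)) (at x)"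
    by (rule has_derivative_eq_rhs) (use \<open>x \<noteq> 0\<close> in \<open>simp add: fun_eq_iff field_simps\<close>)
qed (use assms has_polar_derivs_continuous[OF assms(1)] has_polar_derivs_continuous[OF assms(2)] in
    \<open>auto simp: has_polar_derivs_def intro!: continuous_intros\<close>)

lemma has_polar_derivs_cmult:
  assumes "has_polar_derivs f fE fR"
  shows "has_polar_derivs (\<lambda>x. c * f x) (\<lambda>x. c * fE x) (\<lambda>x. c * fR x)"
  using has_polar_derivs_mult[OF has_polar_derivs_const assms, of c] by simp

text \<open>A radial power is an eigenfunction of E and constant in the angle. This serves twice:
  with exponent \<alpha> or -\<alpha> for the weights, and with exponent -1 for the factor between u
  and w.\<close>

lemma has_polar_derivs_norm_powr:
  "has_polar_derivs (\<lambda>x. norm x powr \<beta>) (\<lambda>x. \<beta> * norm x powr \<beta>) (\<lambda>x. 0)"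
  unfolding has_polar_derivs_def
proof (intro conjI allI impI)
  fix x :: "real^2" assume x: "x \<noteq> 0"
  have "((\<lambda>x. norm x powr \<beta>) has_derivative (\<lambda>h. (\<beta> * norm x powr (\<beta> - 1)) * (x \<bullet> h / norm x))) (at x)"
  proof (rule has_derivative_compose[of norm, THEN has_derivative_eq_rhs])
    show "(norm has_derivative (\<lambda>h. x \<bullet> h / norm x)) (at x)"
      using has_derivative_norm[OF x] by (simp add: sgn_div_norm inner_commute divide_inverse mult.commute)
    show "((\<lambda>r. r powr \<beta>) has_derivative (*) (\<beta> * norm x powr (\<beta> - 1))) (at (norm x))"
      using has_real_derivative_powr[of "norm x" \<beta>] x by (simp add: has_field_derivative_def)
  qed simp
  then show "((\<lambda>x. norm x powr \<beta>) has_derivative (\<lambda>h. (\<beta> * norm x powr \<beta> * (x \<bullet> h) +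
      0 * (x $ 1 * h $ 2 - x $ 2 * h $ 1)) / (norm x)\<^sup>2)) (at x)"
    by (rule has_derivative_eq_rhs)
       (use x in \<open>simp add: fun_eq_iff powr_diff power2_eq_square\<close>)
qed (auto intro!: continuous_intros)

text \<open>The vectors x and (-x2, x1) are orthogonal of length |x|; expanding h in this basis
  turns the gradient pairing into the polar form.\<close>

lemma has_polar_derivs_differentiable:
  assumes "\<And>x. f differentiable (at x)" "\<And>i. continuous_on UNIV (partial i f)"
  shows "has_polar_derivs f (\<lambda>x. x $ 1 * partial 1 f x + x $ 2 * partial 2 f x)
    (\<lambda>x. x $ 1 * partial 2 f x - x $ 2 * partial 1 f x)"
  unfolding has_polar_derivs_def
proof (intro conjI allI impI)
  fix x :: "real^2" assume x: "x \<noteq> 0"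
  have "(f has_derivative (\<lambda>h. h $ 1 * partial 1 f x + h $ 2 * partial 2 f x)) (at x)"
    using has_derivative_partial[OF assms(1)[of x]] by (simp add: sum_2)
  then show "(f has_derivative (\<lambda>h. ((x $ 1 * partial 1 f x + x $ 2 * partial 2 f x) * (x \<bullet> h) +
      (x $ 1 * partial 2 f x - x $ 2 * partial 1 f x) * (x $ 1 * h $ 2 - x $ 2 * h $ 1)) / (norm x)\<^sup>2)) (at x)"
  proof (rule has_derivative_eq_rhs)
    have n: "(x $ 1)\<^sup>2 + (x $ 2)\<^sup>2 \<noteq> 0" using x norm_sq_2[of x] by (metis norm_eq_zero zero_eq_power2)
    show "(\<lambda>h. h $ 1 * partial 1 f x + h $ 2 * partial 2 f x) =
      (\<lambda>h. ((x $ 1 * partial 1 f x + x $ 2 * partial 2 f x) * (x \<bullet> h) +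
      (x $ 1 * partial 2 f x - x $ 2 * partial 1 f x) * (x $ 1 * h $ 2 - x $ 2 * h $ 1)) / (norm x)\<^sup>2)"
    proof
      fix h :: "real^2"
      have "(h $ 1 * partial 1 f x + h $ 2 * partial 2 f x) * ((x $ 1)\<^sup>2 + (x $ 2)\<^sup>2) =
        (x $ 1 * partial 1 f x + x $ 2 * partial 2 f x) * (x \<bullet> h) +
        (x $ 1 * partial 2 f x - x $ 2 * partial 1 f x) * (x $ 1 * h $ 2 - x $ 2 * h $ 1)"
        by (simp add: inner_2 power2_eq_square algebra_simps)
      then show "h $ 1 * partial 1 f x + h $ 2 * partial 2 f x =
         ((x $ 1 * partial 1 f x + x $ 2 * partial 2 f x) * (x \<bullet> h) +
        (x $ 1 * partial 2 f x - x $ 2 * partial 1 f x) * (x $ 1 * h $ 2 - x $ 2 * h $ 1)) / (norm x)\<^sup>2"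
        using n by (simp add: norm_sq_2 nonzero_eq_divide_eq)
    qed
  qed
qed (intro continuous_intros continuous_on_subset[OF assms(2)] subset_UNIV)+

lemma has_polar_derivs_smooth:
  "smooth f \<Longrightarrow> has_polar_derivs f (\<lambda>x. x $ 1 * partial 1 f x + x $ 2 * partial 2 f x)
    (\<lambda>x. x $ 1 * partial 2 f x - x $ 2 * partial 1 f x)"
  by (intro has_polar_derivs_differentiable smooth_differentiable smooth_continuous_on smooth_partial)

lemma partial_nth: "partial i (\<lambda>x::real^2. x $ k) x = (if i = k then 1 else 0)"
  by (subst partial_eqI[where f'="\<lambda>h. h $ k"])
     (auto simp: axis_def intro!: derivative_eq_intros bounded_linear_imp_has_derivative bounded_linear_vec_nth)

text \<open>Component i of x turned by a right angle, which is also the angular derivative of the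
  coordinate i.\<close>

definition rot :: "2 \<Rightarrow> real ^ 2 \<Rightarrow> real" where
  "rot i x = (if i = 1 then - x $ 2 else x $ 1)"

lemma has_polar_derivs_nth: "has_polar_derivs (\<lambda>x. x $ k) (\<lambda>x. x $ k) (rot k)"
proof -
  have *: "has_polar_derivs (\<lambda>x. x $ k)
     (\<lambda>x. x $ 1 * partial 1 (\<lambda>x. x $ k) x + x $ 2 * partial 2 (\<lambda>x. x $ k) x)
     (\<lambda>x. x $ 1 * partial 2 (\<lambda>x. x $ k) x - x $ 2 * partial 1 (\<lambda>x. x $ k) x)"
    by (rule has_polar_derivs_differentiable)
       (auto simp: partial_nth[abs_def] intro!: bounded_linear_imp_differentiable bounded_linear_vec_nth)
  show ?thesis
    by (rule has_polar_derivs_eq[OF *]) (use exhaust_2[of k] in \<open>auto simp: partial_nth rot_def\<close>)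
qed

text \<open>Near x the function is identically 0, so its derivative is the zero map. Evaluating that
  map at x isolates \<open>fE x\<close>, and at x turned by a right angle isolates
  \<open>fR x\<close>.\<close>

lemma has_polar_derivs_vanish:
  assumes "has_polar_derivs f fE fR" "closed K" "\<And>x. x \<notin> K \<Longrightarrow> x \<noteq> 0 \<Longrightarrow> f x = 0" "x \<notin> K" "x \<noteq> 0"
  shows "fE x = 0" "fR x = 0"
proof -
  let ?D = "\<lambda>h. (fE x * (x \<bullet> h) + fR x * (x $ 1 * h $ 2 - x $ 2 * h $ 1)) / (norm x)\<^sup>2"
  have "(f has_derivative ?D) (at x)"
    using assms by (auto simp: has_polar_derivs_def)
  moreover have "open (- (insert 0 K))"
    using assms(2) by (simp add: open_Compl)
  then have "(f has_derivative (\<lambda>h. 0)) (at x)"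
    by (rule has_derivative_transform_within_open[OF has_derivative_const]) (use assms in auto)
  ultimately have D: "?D = (\<lambda>h. 0)"
    by (rule has_derivative_unique)
  have n: "(norm x)\<^sup>2 \<noteq> 0" using assms by simp
  from fun_cong[OF D, of x] n show "fE x = 0"
    by (simp add: power2_norm_eq_inner)
  let ?h = "vector [- x $ 2, x $ 1] :: real^2"
  have h: "x \<bullet> ?h = 0" "x $ 1 * ?h $ 2 - x $ 2 * ?h $ 1 = (norm x)\<^sup>2"
    unfolding norm_sq_2 by (simp_all add: inner_2 vector_2 power2_eq_square)
  from fun_cong[OF D, of ?h] n show "fR x = 0"
    unfolding h by simp
qed

section \<open>Integration against dx / |x|^2\<close>

definition polar_integral :: "(real ^ 2 \<Rightarrow> real) \<Rightarrow> real" where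
  "polar_integral f = (LINT x|lebesgue. f x / (norm x)\<^sup>2)"

text \<open>The origin is exempted because polar derivatives are specified only away from it; in the
  integrand its value is killed by division by zero.\<close>

definition supported_away :: "(real ^ 2) set \<Rightarrow> (real ^ 2 \<Rightarrow> real) \<Rightarrow> bool" where
  "supported_away K f \<longleftrightarrow> continuous_on (- {0}) f \<and> (\<forall>x. x \<notin> K \<longrightarrow> x \<noteq> 0 \<longrightarrow> f x = 0)"

context
  fixes K :: "(real ^ 2) set"
  assumes K: "compact K" "0 \<notin> K"
begin

lemma supported_away_integrable:
  assumes "supported_away K f"
  shows "integrable lebesgue (\<lambda>x. f x / (norm x)\<^sup>2)"
proof (rule integrable_continuous_on_compact_support(2)[OF K(1)])
  have "continuous_on K f"
    using assms K(2) by (auto simp: supported_away_def intro: continuous_on_subset)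
  then show "continuous_on K (\<lambda>x. f x / (norm x)\<^sup>2)"
    using K(2) by (intro continuous_intros) auto
  show "f x / (norm x)\<^sup>2 = 0" if "x \<notin> K" for x
    using assms that by (cases "x = 0") (auto simp: supported_away_def)
qed

lemma polar_integral_add:
  "supported_away K f \<Longrightarrow> supported_away K g \<Longrightarrow>
    polar_integral (\<lambda>x. f x + g x) = polar_integral f + polar_integral g"
  unfolding polar_integral_def
  by (simp add: add_divide_distrib supported_away_integrable)

lemma polar_integral_cmult: "polar_integral (\<lambda>x. c * f x) = c * polar_integral f"
  unfolding polar_integral_def by (simp flip: times_divide_eq_right)

lemma polar_integral_mono:
  assumes "supported_away K f" "supported_away K g" "\<And>x. x \<in> K \<Longrightarrow> f x \<le> g x"
  shows "polar_integral f \<le> polar_integral g"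
  unfolding polar_integral_def
proof (intro integral_mono supported_away_integrable assms)
  show "f x / (norm x)\<^sup>2 \<le> g x / (norm x)\<^sup>2" for x
    using assms by (cases "x \<in> K"; cases "x = 0") (auto simp: supported_away_def divide_right_mono)
qed

text \<open>The vector fields \<open>x / |x|\<^sup>2\<close> and \<open>(- x\<^sub>2, x\<^sub>1) / |x|\<^sup>2\<close> are divergence free, so both integrals
  are integrals of divergences.\<close>

lemma polar_integral_derivs_eq_0:
  assumes f: "has_polar_derivs f fE fR" and supp: "\<And>x. x \<notin> K \<Longrightarrow> x \<noteq> 0 \<Longrightarrow> f x = 0"
  shows "polar_integral fE = 0" "polar_integral fR = 0"
proof -
  have vanish: "fE x = 0" "fR x = 0" if "x \<notin> K" "x \<noteq> 0" for x
    by (rule has_polar_derivs_vanish[OF f compact_imp_closed[OF K(1)] _ that]; fact supp)+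
  \<comment> \<open>F 1 and F 2 will be the components of the field f x / |x|^2.\<close>
  define g where "g x = f x * norm x powr - 2" for x
  define gE where "gE x = fE x * norm x powr - 2 + f x * (- 2 * norm x powr - 2)" for x
  define gR where "gR x = fR x * norm x powr - 2" for x
  have g: "has_polar_derivs g gE gR"
    using has_polar_derivs_mult[OF f has_polar_derivs_norm_powr[of "- 2"]]
    unfolding g_def gE_def gR_def by simp
  define F where "F k x = x $ k * g x" for k :: 2 and x :: "real^2"
  define FE where "FE k x = x $ k * g x + x $ k * gE x" for k :: 2 and x
  define FR where "FR k x = rot k x * g x + x $ k * gR x" for k :: 2 and x
  have F: "has_polar_derivs (F k) (FE k) (FR k)" for k
    unfolding F_def FE_def FR_def by (rule has_polar_derivs_mult[OF has_polar_derivs_nth g])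
  \<comment> \<open>\<open>G k i\<close> is the partial derivative of \<open>F k\<close> in
    direction i, written through polar derivatives so that the same formula gives 0 at the
    origin.\<close>
  define G where "G k i x = (FE k x * x $ i + FR k x * rot i x) / (norm x)\<^sup>2" for k i :: 2 and x :: "real^2"
  have G: "integrable lebesgue (G k i)" "(LINT x|lebesgue. G k i x) = 0" for k i
  proof -
    have F0: "F k x = 0" if "x \<notin> K" for x
      using supp[OF that] by (cases "x = 0") (auto simp: F_def g_def)
    have G0: "G k i x = 0" if "x \<notin> K" for x
      using supp[OF that] vanish[OF that]
      by (cases "x = 0") (auto simp: G_def FE_def FR_def g_def gE_def gR_def)
    have Fd: "(F k has_derivative (\<lambda>h. h $ 1 * G k 1 x + h $ 2 * G k 2 x)) (at x)" for x
    proof (cases "x \<in> K")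
      case False
      have "open (- K)" using K(1) by (simp add: compact_imp_closed open_Compl)
      with has_derivative_const have "(F k has_derivative (\<lambda>h. 0)) (at x)"
        by (rule has_derivative_transform_within_open) (use False F0 in auto)
      moreover have "(\<lambda>h. h $ 1 * G k 1 x + h $ 2 * G k 2 x) = (\<lambda>h::real^2. 0)"
        using supp[OF False] vanish[OF False]
        by (cases "x = 0") (auto simp: G_def FE_def FR_def g_def gE_def gR_def)
      ultimately show ?thesis by simp
    next
      case True
      then have x: "x \<noteq> 0" using K(2) by auto
      then have "(F k has_derivative (\<lambda>h. (FE k x * (x \<bullet> h) +
          FR k x * (x $ 1 * h $ 2 - x $ 2 * h $ 1)) / (norm x)\<^sup>2)) (at x)"
        using F[of k] by (auto simp: has_polar_derivs_def)
      then show ?thesis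
        by (rule has_derivative_eq_rhs)
           (use x in \<open>simp add: fun_eq_iff G_def inner_2 rot_def field_simps\<close>)
    qed
    have cont: "continuous_on K (G k i)"
    proof -
      have "continuous_on K (FE k)" "continuous_on K (FR k)"
        using F[of k] K(2) by (auto simp: has_polar_derivs_def intro: continuous_on_subset)
      then show ?thesis
        unfolding G_def rot_def using K(2) by (cases "i = 1") (auto intro!: continuous_intros)
    qed
    then have "bounded (G k i ` K)"
      using K(1) by (intro compact_imp_bounded compact_continuous_image)
    then obtain B where B: "\<And>x. x \<in> K \<Longrightarrow> \<bar>G k i x\<bar> \<le> B"
      by (auto simp: bounded_iff)
    have line: "((\<lambda>t. F k (x + t *\<^sub>R axis i 1)) has_real_derivative G k i x) (at 0)" for x
    proof -
      have "F k differentiable (at x)" using Fd by (auto simp: differentiable_def)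
      moreover have "partial i (F k) x = G k i x"
        using partial_eqI[OF Fd, of i] exhaust_2[of i] by (auto simp: axis_def)
      ultimately show ?thesis
        using has_real_derivative_along[of "F k" x 0 i] by simp
    qed
    have bd: "\<bar>G k i x\<bar> \<le> max B 0" for x
      using B[of x] G0[of x] by (cases "x \<in> K") auto
    have contF: "continuous_on UNIV (F k)"
      using Fd by (intro continuous_at_imp_continuous_on ballI) (blast intro: has_derivative_continuous)
    show "integrable lebesgue (G k i)" "(LINT x|lebesgue. G k i x) = 0"
      using integral_directional_derivative_eq_0[OF K(1) contF F0 line bd] by auto
  qed
  have "fE x / (norm x)\<^sup>2 = G 1 1 x + G 2 2 x" "fR x / (norm x)\<^sup>2 = G 1 2 x - G 2 1 x" for x
  proof -
    have "fE x / (norm x)\<^sup>2 = G 1 1 x + G 2 2 x \<and> fR x / (norm x)\<^sup>2 = G 1 2 x - G 2 1 x"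
    proof (cases "x = 0")
      case False
      then have n: "(norm x)\<^sup>2 \<noteq> 0" by simp
      \<comment> \<open>The coordinates contribute 2 g to the divergence, which cancels the
        eigenvalue -2 of |x|^(-2) inside gE; what remains is fE / |x|^2. The second line is the
        divergence of the field turned by a right angle.\<close>
      have "FE 1 x * x $ 1 + FR 1 x * rot 1 x + (FE 2 x * x $ 2 + FR 2 x * rot 2 x) = (norm x)\<^sup>2 * (2 * g x + gE x)"
        "FE 1 x * x $ 2 + FR 1 x * rot 2 x - (FE 2 x * x $ 1 + FR 2 x * rot 1 x) = (norm x)\<^sup>2 * gR x"
        unfolding norm_sq_2 by (simp_all add: FE_def FR_def rot_def power2_eq_square algebra_simps)
      then have "G 1 1 x + G 2 2 x = 2 * g x + gE x" "G 1 2 x - G 2 1 x = gR x"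
        using n by (simp_all add: G_def add_divide_distrib[symmetric] diff_divide_distrib[symmetric])
      then show ?thesis
        using False by (simp add: g_def gE_def gR_def powr_minus_divide)
    qed (simp add: G_def)
    then show "fE x / (norm x)\<^sup>2 = G 1 1 x + G 2 2 x" "fR x / (norm x)\<^sup>2 = G 1 2 x - G 2 1 x"
      by auto
  qed
  then show "polar_integral fE = 0" "polar_integral fR = 0"
    using G unfolding polar_integral_def by simp_all
qed

end

text \<open>The hypotheses on \<open>wE\<close> and \<open>wR\<close> share \<open>wER\<close>: this is the commutation of \<open>E\<close> and \<open>R\<close>.\<close>

lemma polar_energy_estimate:
  fixes w wE wR wEE wER wRR \<phi> :: "real ^ 2 \<Rightarrow> real" and m \<sigma> :: real
  assumes K: "compact K" "0 \<notin> K" and supp: "\<And>x. x \<notin> K \<Longrightarrow> x \<noteq> 0 \<Longrightarrow> w x = 0"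
    and w: "has_polar_derivs w wE wR" and wE: "has_polar_derivs wE wEE wER"
    and wR: "has_polar_derivs wR wER wRR"
    and \<phi>: "has_polar_derivs \<phi> (\<lambda>x. \<sigma> * \<phi> x) (\<lambda>x. 0)" "\<And>x. x \<in> K \<Longrightarrow> 0 \<le> \<phi> x" "\<And>x. x \<in> K \<Longrightarrow> \<phi> x \<le> 1"
    and m: "m > 0" and \<sigma>: "\<sigma> \<noteq> 0"
  defines "P \<equiv> polar_integral (\<lambda>x. (wEE x + 2 * m * wE x + m\<^sup>2 * w x + wRR x)\<^sup>2)"
  shows "polar_integral (\<lambda>x. \<phi> x * (w x)\<^sup>2) \<le> 1 / (\<sigma>\<^sup>2 * m\<^sup>2) * P"
    and "polar_integral (\<lambda>x. \<phi> x * ((w x + wE x)\<^sup>2 + (wR x)\<^sup>2)) \<le>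
      ((5 / 2 + \<bar>\<sigma>\<bar> / 2 + m\<^sup>2) / (\<sigma>\<^sup>2 * m\<^sup>2) + 1 / 2 + (\<bar>\<sigma>\<bar> / 2 + 2) / (4 * m\<^sup>2)) * P"
proof -
  note vanish = has_polar_derivs_vanish[OF _ compact_imp_closed[OF K(1)]]
  have sE: "wE x = 0" and sR: "wR x = 0" if "x \<notin> K" "x \<noteq> 0" for x
    using vanish[OF w supp that] by blast+
  have sEE: "wEE x = 0" and sER: "wER x = 0" if "x \<notin> K" "x \<noteq> 0" for x
    using vanish[OF wE sE that] by blast+
  have sRR: "wRR x = 0" if "x \<notin> K" "x \<noteq> 0" for x
    using vanish[OF wR sR that] by blast
  have c: "continuous_on (- {0}) \<phi>" "continuous_on (- {0}) w" "continuous_on (- {0}) wE"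
    "continuous_on (- {0}) wR" "continuous_on (- {0}) wEE" "continuous_on (- {0}) wER" "continuous_on (- {0}) wRR"
    using has_polar_derivs_continuous[OF \<phi>(1)] w wE wR has_polar_derivs_continuous[OF w]
    by (auto simp: has_polar_derivs_def)
  define S where "S x = wEE x + m\<^sup>2 * w x + wRR x" for x
  have sS: "S x = 0" if "x \<notin> K" "x \<noteq> 0" for x
    using that supp sEE sRR by (simp add: S_def)
  have cS: "continuous_on (- {0}) S"
    unfolding S_def by (intro continuous_intros c)
  note supps = supp sE sR sEE sER sRR sS
  note conts = c cS
  note add = polar_integral_add[OF K] and cmult = polar_integral_cmult[OF K]
    and mono = polar_integral_mono[OF K] and zero = polar_integral_derivs_eq_0[OF K]
  let ?I = polar_integral

  have "?I (\<lambda>x. S x * wE x) = 0"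
  proof -
    \<comment> \<open>The E-derivative of (wE^2 + m^2 w^2 - wR^2) / 2 is S wE up to the term wRR wE
      + wR wER, which is the R-derivative of wR wE. So S wE is a sum of two total
      derivatives.\<close>
    have G: "has_polar_derivs (\<lambda>x. 1 / 2 * (wE x * wE x) + m\<^sup>2 / 2 * (w x * w x) + (- 1 / 2) * (wR x * wR x))
       (\<lambda>x. 1 / 2 * (wEE x * wE x + wE x * wEE x) + m\<^sup>2 / 2 * (wE x * w x + w x * wE x) + (- 1 / 2) * (wER x * wR x + wR x * wER x))
       (\<lambda>x. 1 / 2 * (wER x * wE x + wE x * wER x) + m\<^sup>2 / 2 * (wR x * w x + w x * wR x) + (- 1 / 2) * (wRR x * wR x + wR x * wRR x))"
      by (intro has_polar_derivs_add has_polar_derivs_cmult has_polar_derivs_mult w wE wR)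
    have 1: "?I (\<lambda>x. 1 / 2 * (wEE x * wE x + wE x * wEE x) + m\<^sup>2 / 2 * (wE x * w x + w x * wE x) + (- 1 / 2) * (wER x * wR x + wR x * wER x)) = 0"
      by (rule zero(1)[OF G]) (simp add: supps)
    have 2: "?I (\<lambda>x. wRR x * wE x + wR x * wER x) = 0"
      by (rule zero(2)[OF has_polar_derivs_mult[OF wR wE]]) (simp add: supps)
    have "?I (\<lambda>x. S x * wE x) = ?I (\<lambda>x. (1 / 2 * (wEE x * wE x + wE x * wEE x) + m\<^sup>2 / 2 * (wE x * w x + w x * wE x) + (- 1 / 2) * (wER x * wR x + wR x * wER x))
        + (wRR x * wE x + wR x * wER x))"
      by (simp add: S_def algebra_simps)
    also have "\<dots> = 0"
      by (subst add, (auto simp: supported_away_def supps intro!: continuous_intros conts)[2]) (simp only: 1 2 add_0_right)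
    finally show ?thesis .
  qed
  have "P = ?I (\<lambda>x. (S x)\<^sup>2 + (4 * m\<^sup>2 * (wE x)\<^sup>2 + 4 * m * (S x * wE x)))"
    unfolding P_def S_def by (simp add: power2_eq_square algebra_simps)
  also have "\<dots> = ?I (\<lambda>x. (S x)\<^sup>2) + (4 * m\<^sup>2 * ?I (\<lambda>x. (wE x)\<^sup>2) + 4 * m * ?I (\<lambda>x. S x * wE x))"
    unfolding cmult[symmetric]
    by (subst add, (auto simp: supported_away_def supps intro!: continuous_intros conts)[2])+ simp
  finally have P: "P = ?I (\<lambda>x. (S x)\<^sup>2) + 4 * m\<^sup>2 * ?I (\<lambda>x. (wE x)\<^sup>2)"
    using \<open>?I (\<lambda>x. S x * wE x) = 0\<close> by simp
  have "?I (\<lambda>x. 0) \<le> ?I (\<lambda>x. (S x)\<^sup>2)" "?I (\<lambda>x. 0) \<le> ?I (\<lambda>x. (wE x)\<^sup>2)"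
    by (intro mono; auto simp: supported_away_def supps intro!: continuous_intros conts)+
  then have nn: "0 \<le> ?I (\<lambda>x. (S x)\<^sup>2)" "0 \<le> ?I (\<lambda>x. (wE x)\<^sup>2)"
    by (simp_all add: polar_integral_def)
  have IS: "?I (\<lambda>x. (S x)\<^sup>2) \<le> P"
    using P nn(2) m by simp
  have IE: "?I (\<lambda>x. (wE x)\<^sup>2) \<le> 1 / (4 * m\<^sup>2) * P"
    using P nn(1) m by (simp add: field_simps)

  have Iw: "?I (\<lambda>x. \<phi> x * (w x)\<^sup>2) \<le> 4 / \<sigma>\<^sup>2 * ?I (\<lambda>x. (wE x)\<^sup>2)"
  proof -
    have 0: "?I (\<lambda>x. \<sigma> * \<phi> x * (w x * w x) + \<phi> x * (wE x * w x + w x * wE x)) = 0"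
      by (rule zero(1)[OF has_polar_derivs_mult[OF \<phi>(1) has_polar_derivs_mult[OF w w]]])
         (simp add: supps)
    have "?I (\<lambda>x. \<phi> x * (w x)\<^sup>2) \<le>
      ?I (\<lambda>x. 2 / \<sigma> * (\<sigma> * \<phi> x * (w x * w x) + \<phi> x * (wE x * w x + w x * wE x)) + 4 / \<sigma>\<^sup>2 * (wE x)\<^sup>2)"
    proof (rule mono)
      fix x assume x: "x \<in> K"
      \<comment> \<open>Hardy by completing a square: E (\<phi> w^2), whose integral is 0, enters
        with the factor 2 / \<sigma>. The term with 1 - \<phi> uses \<phi> \<le> 1 to remove the
        weight from wE^2.\<close>
      have "0 \<le> \<phi> x * (w x + 2 / \<sigma> * wE x)\<^sup>2 + (1 - \<phi> x) * (2 / \<sigma> * wE x)\<^sup>2"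
        using \<phi>(2,3)[OF x] by simp
      also have "\<dots> = 2 / \<sigma> * (\<sigma> * \<phi> x * (w x * w x) + \<phi> x * (wE x * w x + w x * wE x)) + 4 / \<sigma>\<^sup>2 * (wE x)\<^sup>2 - \<phi> x * (w x)\<^sup>2"
        using \<sigma> by (simp add: power2_eq_square field_simps)
      finally show "\<phi> x * (w x)\<^sup>2 \<le> 2 / \<sigma> * (\<sigma> * \<phi> x * (w x * w x) + \<phi> x * (wE x * w x + w x * wE x)) + 4 / \<sigma>\<^sup>2 * (wE x)\<^sup>2"
        by simp
    qed (use \<sigma> in \<open>auto simp: supported_away_def supps intro!: continuous_intros conts\<close>)
    also have "\<dots> = 2 / \<sigma> * ?I (\<lambda>x. \<sigma> * \<phi> x * (w x * w x) + \<phi> x * (wE x * w x + w x * wE x)) + 4 / \<sigma>\<^sup>2 * ?I (\<lambda>x. (wE x)\<^sup>2)"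
      unfolding cmult[symmetric]
      by (subst add) (use \<sigma> in \<open>auto simp: supported_away_def supps intro!: continuous_intros conts\<close>)
    finally show ?thesis unfolding 0 by simp
  qed
  also have "\<dots> \<le> 4 / \<sigma>\<^sup>2 * (1 / (4 * m\<^sup>2) * P)"
    using IE by (intro mult_left_mono) auto
  finally show Iw': "?I (\<lambda>x. \<phi> x * (w x)\<^sup>2) \<le> 1 / (\<sigma>\<^sup>2 * m\<^sup>2) * P"
    by simp

  \<comment> \<open>In \<open>?a\<close>, 5/2 is 2 from (w + wE)^2 plus 1/2 from w S, |\<sigma>| / 2
    comes from \<sigma> w wE, and m^2 from w (wEE + wRR) = w S - m^2 w^2. In \<open>?b\<close> the
    parts come from \<sigma> w wE and (w + wE)^2.\<close>
  let ?a = "5 / 2 + \<bar>\<sigma>\<bar> / 2 + m\<^sup>2" and ?b = "\<bar>\<sigma>\<bar> / 2 + 2"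
  \<comment> \<open>\<open>?A\<close> is E (\<phi> w wE) and \<open>?B\<close> is R (\<phi> w wR).
    Their sum contains \<phi> wR^2, so up to integrals equal to 0 that term is expressed through w,
    wE and S.\<close>
  let ?A = "\<lambda>x. \<sigma> * \<phi> x * (w x * wE x) + \<phi> x * (wE x * wE x + w x * wEE x)"
  let ?B = "\<lambda>x. 0 * (w x * wR x) + \<phi> x * (wR x * wR x + w x * wRR x)"
  have 0: "?I ?A = 0" "?I ?B = 0"
    by (rule zero(1)[OF has_polar_derivs_mult[OF \<phi>(1) has_polar_derivs_mult[OF w wE]]], simp add: supps)
       (rule zero(2)[OF has_polar_derivs_mult[OF \<phi>(1) has_polar_derivs_mult[OF w wR]]], simp add: supps)
  have "?I (\<lambda>x. \<phi> x * ((w x + wE x)\<^sup>2 + (wR x)\<^sup>2)) \<le>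
    ?I (\<lambda>x. ?A x + (?B x + (?a * (\<phi> x * (w x)\<^sup>2) + (1 / 2 * (S x)\<^sup>2 + ?b * (wE x)\<^sup>2))))"
  proof (rule mono)
    fix x assume x: "x \<in> K"
    have "- (\<sigma> * (w x * wE x)) \<le> \<bar>\<sigma>\<bar> / 2 * (w x)\<^sup>2 + \<bar>\<sigma>\<bar> / 2 * (wE x)\<^sup>2"
    proof -
      have "\<bar>w x * wE x\<bar> \<le> ((w x)\<^sup>2 + (wE x)\<^sup>2) / 2"
        using sum_squares_bound[of "\<bar>w x\<bar>" "\<bar>wE x\<bar>"] by (simp add: abs_mult)
      from mult_left_mono[OF this, of "\<bar>\<sigma>\<bar>"] show ?thesis
        using abs_ge_minus_self[of "\<sigma> * (w x * wE x)"] by (simp add: abs_mult distrib_left add_divide_distrib)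
    qed
    moreover have "- (w x * S x) \<le> ((w x)\<^sup>2 + (S x)\<^sup>2) / 2"
      using zero_le_power2[of "w x + S x"] by (simp add: power2_sum)
    moreover have "(w x + wE x)\<^sup>2 \<le> 2 * (w x)\<^sup>2 + 2 * (wE x)\<^sup>2"
      using zero_le_power2[of "w x - wE x"] by (simp add: power2_sum power2_diff)
    moreover have "X - E2 - sw - wS + mm \<le> 5 / 2 * W + sW + mm + (1 / 2 * S2 + (sE + 2 * E2))"
      if "- sw \<le> sW + sE" "- wS \<le> (W + S2) / 2" "X \<le> 2 * W + 2 * E2" "0 \<le> E2"
      for X E2 sw wS mm W sW S2 sE :: real
      using that by (simp add: field_simps)
    ultimately have
      "(w x + wE x)\<^sup>2 - (wE x)\<^sup>2 - \<sigma> * (w x * wE x) - w x * S x + m\<^sup>2 * (w x)\<^sup>2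
        \<le> ?a * (w x)\<^sup>2 + (1 / 2 * (S x)\<^sup>2 + ?b * (wE x)\<^sup>2)" (is "?l \<le> ?a * (w x)\<^sup>2 + ?r")
      by (simp only: distrib_right zero_le_power2)
    then have "\<phi> x * ?l \<le> \<phi> x * (?a * (w x)\<^sup>2 + ?r)"
      using \<phi>(2)[OF x] by (rule mult_left_mono)
    \<comment> \<open>Only S^2 and wE^2 shed the weight here; w^2 keeps it, since the Hardy bound
      controls just the weighted integral.\<close>
    also have "\<dots> \<le> ?a * (\<phi> x * (w x)\<^sup>2) + ?r"
    proof -
      have "\<phi> x * ?r \<le> 1 * ?r"
        using \<phi>(3)[OF x] by (intro mult_right_mono add_nonneg_nonneg mult_nonneg_nonneg) auto
      then show ?thesis by (simp add: algebra_simps)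
    qed
    moreover have "\<phi> x * ((w x + wE x)\<^sup>2 + (wR x)\<^sup>2) = ?A x + ?B x + \<phi> x * ?l"
      by (simp add: S_def power2_eq_square algebra_simps)
    ultimately show "\<phi> x * ((w x + wE x)\<^sup>2 + (wR x)\<^sup>2) \<le>
       ?A x + (?B x + (?a * (\<phi> x * (w x)\<^sup>2) + (1 / 2 * (S x)\<^sup>2 + ?b * (wE x)\<^sup>2)))"
      by linarith
  qed (auto simp: supported_away_def supps intro!: continuous_intros conts)
  also have "\<dots> = ?I ?A + (?I ?B + (?a * ?I (\<lambda>x. \<phi> x * (w x)\<^sup>2) +
      (1 / 2 * ?I (\<lambda>x. (S x)\<^sup>2) + ?b * ?I (\<lambda>x. (wE x)\<^sup>2))))"
    unfolding cmult[symmetric]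
    by (subst add, (auto simp: supported_away_def supps intro!: continuous_intros conts)[2])+ simp
  also have "\<dots> \<le> ?a * (1 / (\<sigma>\<^sup>2 * m\<^sup>2) * P) + (1 / 2 * P + ?b * (1 / (4 * m\<^sup>2) * P))"
    unfolding 0 using Iw' IS IE by (simp only: add_0) (intro add_mono mult_left_mono; simp)
  also have "\<dots> = (?a / (\<sigma>\<^sup>2 * m\<^sup>2) + 1 / 2 + ?b / (4 * m\<^sup>2)) * P"
  proof -
    have "k * (1 / X * P) + (1 / 2 * P + l * (1 / Y * P)) = (k / X + 1 / 2 + l / Y) * P" for k l X Y
      by (simp add: distrib_right)
    then show ?thesis .
  qed
  finally show "?I (\<lambda>x. \<phi> x * ((w x + wE x)\<^sup>2 + (wR x)\<^sup>2)) \<le>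
      (?a / (\<sigma>\<^sup>2 * m\<^sup>2) + 1 / 2 + ?b / (4 * m\<^sup>2)) * P" .
qed

section \<open>The estimates for smooth u supported away from the origin\<close>

definition classical_L :: "real \<Rightarrow> (real ^ 2 \<Rightarrow> real) \<Rightarrow> real ^ 2 \<Rightarrow> real" where
  "classical_L m u x =
     partial 1 (partial 1 u) x + partial 2 (partial 2 u) x
     + 2 * (m - 1) * ((x $ 1 * partial 1 u x + x $ 2 * partial 2 u x) / (norm x)\<^sup>2)
     + (m - 1)\<^sup>2 / (norm x)\<^sup>2 * u x"

text \<open>This is the factor of the gradient bound in \<open>polar_energy_estimate\<close> with
  |\<sigma>| = \<alpha>. It also dominates the factor 1 / (\<sigma>^2 m^2) of the bound for w, so
  one constant serves both inequalities.\<close>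

definition energy_const :: "real \<Rightarrow> real \<Rightarrow> real" where
  "energy_const m \<alpha> = (5 / 2 + \<alpha> / 2 + m\<^sup>2) / (\<alpha>\<^sup>2 * m\<^sup>2) + 1 / 2 + (\<alpha> / 2 + 2) / (4 * m\<^sup>2)"

text \<open>Dictionary for w = u / |x|: w^2 / |x|^2 is u^2 / |x|^4, while w + wE = uE / |x| and wR =
  uR / |x|, so that (w + wE)^2 + wR^2 is the squared gradient of u. The instances used are c =
  b^(-\<alpha>) with \<sigma> = \<alpha>, and c = a^\<alpha> with \<sigma> = -\<alpha>.\<close>

lemma smooth_estimate:
  fixes u :: "real ^ 2 \<Rightarrow> real" and m \<sigma> c :: real
  assumes K: "compact K" "0 \<notin> K" and supp: "\<And>x. x \<notin> K \<Longrightarrow> u x = 0" and u: "smooth u"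
    and m: "m > 0" and \<sigma>: "\<sigma> \<noteq> 0"
    and c: "0 \<le> c" "\<And>x. x \<in> K \<Longrightarrow> c * norm x powr \<sigma> \<le> 1"
  shows "integrable lebesgue (\<lambda>x. (classical_L m u x)\<^sup>2)"
    and "integrable lebesgue (\<lambda>x. c * norm x powr \<sigma> * (u x)\<^sup>2 / norm x ^ 4)"
    and "integrable lebesgue (\<lambda>x. c * norm x powr \<sigma> * ((partial 1 u x)\<^sup>2 + (partial 2 u x)\<^sup>2) / (norm x)\<^sup>2)"
    and "(LINT x|lebesgue. c * norm x powr \<sigma> * (u x)\<^sup>2 / norm x ^ 4)
      \<le> energy_const m \<bar>\<sigma>\<bar> * (LINT x|lebesgue. (classical_L m u x)\<^sup>2)"
    and "(LINT x|lebesgue. c * norm x powr \<sigma> * ((partial 1 u x)\<^sup>2 + (partial 2 u x)\<^sup>2) / (norm x)\<^sup>2)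
      \<le> energy_const m \<bar>\<sigma>\<bar> * (LINT x|lebesgue. (classical_L m u x)\<^sup>2)"
proof -
  let ?n = "\<lambda>x::real^2. norm x powr - 1"
  define p where "p = (\<lambda>k. partial k u)"
  define q where "q = (\<lambda>k l. partial k (partial l u))"
  \<comment> \<open>Equality of mixed partials is what lets E and R commute on u, i.e. what allows a
    single \<open>uER\<close> in \<open>UE\<close> and \<open>UR\<close>.\<close>
  have q_sym: "q 2 1 = q 1 2"
    using partial_commute[OF u] by (auto simp: q_def)
  have [simp]: "p k x = 0" "q k l x = 0" "u x = 0" if "x \<notin> K" for k l x
  proof -
    show "u x = 0" by (fact supp[OF that])
    have *: "partial k u x = 0" if "x \<notin> K" for k x
      by (rule partial_zero_outside[OF supp compact_imp_closed[OF K(1)] that])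
    then show "p k x = 0" using that by (simp add: p_def)
    show "q k l x = 0"
      unfolding q_def by (rule partial_zero_outside[OF * compact_imp_closed[OF K(1)] that])
  qed
  define uE where "uE x = x $ 1 * p 1 x + x $ 2 * p 2 x" for x
  define uR where "uR x = x $ 1 * p 2 x - x $ 2 * p 1 x" for x
  define pE where "pE k x = x $ 1 * q 1 k x + x $ 2 * q 2 k x" for k x
  define pR where "pR k x = x $ 1 * q 2 k x - x $ 2 * q 1 k x" for k x
  have U: "has_polar_derivs u uE uR"
    unfolding uE_def uR_def p_def using u by (rule has_polar_derivs_smooth)
  have P: "has_polar_derivs (p k) (pE k) (pR k)" for k
    unfolding pE_def pR_def p_def q_def using u by (intro has_polar_derivs_smooth smooth_partial)
  define uEE where "uEE x = x $ 1 * p 1 x + x $ 1 * pE 1 x + (x $ 2 * p 2 x + x $ 2 * pE 2 x)" for x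
  define uER where "uER x = - x $ 2 * p 1 x + x $ 1 * pR 1 x + (x $ 1 * p 2 x + x $ 2 * pR 2 x)" for x
  define uRR where "uRR x = - x $ 2 * p 2 x + x $ 1 * pR 2 x - (x $ 1 * p 1 x + x $ 2 * pR 1 x)" for x
  have UE: "has_polar_derivs uE uEE uER"
    unfolding uE_def uEE_def uER_def
    by (rule has_polar_derivs_eq[OF has_polar_derivs_add[OF has_polar_derivs_mult[OF has_polar_derivs_nth P]
          has_polar_derivs_mult[OF has_polar_derivs_nth P]]]) (auto simp: rot_def)
  have "has_polar_derivs (\<lambda>x. x $ 1 * p 2 x + (- 1) * (x $ 2 * p 1 x)) uER uRR"
    by (rule has_polar_derivs_eq[OF has_polar_derivs_add[OF has_polar_derivs_mult[OF has_polar_derivs_nth P]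
          has_polar_derivs_cmult[OF has_polar_derivs_mult[OF has_polar_derivs_nth P]]]])
       (auto simp: rot_def uER_def uRR_def pE_def pR_def q_sym algebra_simps)
  then have UR: "has_polar_derivs uR uER uRR"
    by (simp add: uR_def[abs_def])
  note N = has_polar_derivs_norm_powr[of "- 1"]
  \<comment> \<open>As |x|^(-1) has eigenvalue -1, E acts on f / |x| as (E - 1) f / |x|. This gives
    (E - 1) u in wE and (E - 1)^2 u in wEE, while R commutes with the radial factor.\<close>
  define w where "w x = ?n x * u x" for x
  define wE where "wE x = ?n x * (uE x + (- 1) * u x)" for x
  define wR where "wR x = ?n x * uR x" for x
  define wEE where "wEE x = ?n x * (uEE x - 2 * uE x + u x)" for x
  define wER where "wER x = ?n x * (uER x - uR x)" for x
  define wRR where "wRR x = ?n x * uRR x" for x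
  have W: "has_polar_derivs w wE wR"
    unfolding w_def by (rule has_polar_derivs_eq[OF has_polar_derivs_mult[OF N U]])
      (auto simp: wE_def wR_def algebra_simps)
  have WE: "has_polar_derivs wE wEE wER"
    unfolding wE_def
    by (rule has_polar_derivs_eq[OF has_polar_derivs_mult[OF N has_polar_derivs_add[OF UE has_polar_derivs_cmult[OF U]]]])
      (auto simp: wEE_def wER_def algebra_simps)
  have WR: "has_polar_derivs wR wER wRR"
    unfolding wR_def by (rule has_polar_derivs_eq[OF has_polar_derivs_mult[OF N UR]])
      (auto simp: wER_def wRR_def algebra_simps)
  define \<phi> where "\<phi> x = c * norm x powr \<sigma>" for x :: "real^2"
  have \<phi>: "has_polar_derivs \<phi> (\<lambda>x. \<sigma> * \<phi> x) (\<lambda>x. 0)"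
    unfolding \<phi>_def
    by (rule has_polar_derivs_eq[OF has_polar_derivs_cmult[OF has_polar_derivs_norm_powr]]) auto
  have n: "(?n x)\<^sup>2 = 1 / (norm x)\<^sup>2" if "x \<noteq> 0" for x
    using that by (simp add: powr_minus_divide power_divide)
  have L: "(wEE x + 2 * m * wE x + m\<^sup>2 * w x + wRR x)\<^sup>2 / (norm x)\<^sup>2 = (classical_L m u x)\<^sup>2" for x
  proof (cases "x = 0")
    case True
    with K(2) have "p 1 x = 0" "p 2 x = 0" "q 1 1 x = 0" "q 2 2 x = 0" "u x = 0" by auto
    with True show ?thesis by (simp add: classical_L_def p_def[symmetric] q_def)
  next
    case False
    then have r: "(norm x)\<^sup>2 \<noteq> 0" by simp
    \<comment> \<open>The polar form of the Laplacian: E^2 + R^2 is |x|^2 times it.\<close>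
    have "uEE x + uRR x = (norm x)\<^sup>2 * (q 1 1 x + q 2 2 x)"
      unfolding norm_sq_2 by (simp add: uEE_def uRR_def pE_def pR_def q_sym power2_eq_square algebra_simps)
    \<comment> \<open>The identity (E - 1)^2 + 2 m (E - 1) + m^2 = (E + m - 1)^2, expanded.\<close>
    then have "uEE x - 2 * uE x + u x + 2 * m * (uE x - u x) + m\<^sup>2 * u x + uRR x =
        (norm x)\<^sup>2 * (q 1 1 x + q 2 2 x) + 2 * (m - 1) * uE x + (m - 1)\<^sup>2 * u x"
      by (simp add: power2_eq_square algebra_simps)
    also have "\<dots> = (norm x)\<^sup>2 * classical_L m u x"
    proof -
      have "r * A + k * e + d * v = r * (A + k * (e / r) + d / r * v)" if "r \<noteq> 0" for r A k e d v :: real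
        using that by (simp add: field_simps)
      from this[OF r] show ?thesis
        by (simp only: classical_L_def p_def q_def uE_def)
    qed
    finally have E: "uEE x - 2 * uE x + u x + 2 * m * (uE x - u x) + m\<^sup>2 * u x + uRR x =
        (norm x)\<^sup>2 * classical_L m u x" .
    have "wEE x + 2 * m * wE x + m\<^sup>2 * w x + wRR x = ?n x * ((norm x)\<^sup>2 * classical_L m u x)"
      unfolding E[symmetric] wEE_def wE_def w_def wRR_def by (simp add: algebra_simps)
    then show ?thesis
      using n[OF False] r by (simp add: power_mult_distrib power2_eq_square)
  qed
  have Q: "\<phi> x * (w x)\<^sup>2 / (norm x)\<^sup>2 = \<phi> x * (u x)\<^sup>2 / norm x ^ 4" for x
  proof (cases "x = 0")
    case False
    have "norm x ^ 4 = (norm x)\<^sup>2 * (norm x)\<^sup>2" by (simp add: power2_eq_square power4_eq_xxxx)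
    then show ?thesis using n[OF False] by (simp add: w_def power_mult_distrib powr_minus_divide power_divide)
  qed simp
  have G: "\<phi> x * ((w x + wE x)\<^sup>2 + (wR x)\<^sup>2) / (norm x)\<^sup>2 = \<phi> x * ((p 1 x)\<^sup>2 + (p 2 x)\<^sup>2) / (norm x)\<^sup>2" for x
  proof (cases "x = 0")
    case False
    then have r: "(norm x)\<^sup>2 \<noteq> 0" by simp
    have "(w x + wE x)\<^sup>2 + (wR x)\<^sup>2 = (?n x)\<^sup>2 * ((uE x)\<^sup>2 + (uR x)\<^sup>2)"
      by (simp add: w_def wE_def wR_def power2_eq_square algebra_simps)
    also have "(uE x)\<^sup>2 + (uR x)\<^sup>2 = (norm x)\<^sup>2 * ((p 1 x)\<^sup>2 + (p 2 x)\<^sup>2)"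
      unfolding norm_sq_2 by (simp add: uE_def uR_def power2_eq_square algebra_simps)
    finally show ?thesis using n[OF False] r by simp
  qed simp
  have supps: "w x = 0" "wE x = 0" "wR x = 0" "wEE x = 0" "wER x = 0" "wRR x = 0" if "x \<notin> K" for x
    using that by (simp_all add: w_def wE_def wR_def wEE_def wER_def wRR_def uE_def uR_def uEE_def
        uER_def uRR_def pE_def pR_def)
  have conts: "continuous_on (- {0}) \<phi>" "continuous_on (- {0}) w" "continuous_on (- {0}) wE"
    "continuous_on (- {0}) wR" "continuous_on (- {0}) wEE" "continuous_on (- {0}) wRR"
    using has_polar_derivs_continuous[OF \<phi>(1)] W WE WR has_polar_derivs_continuous[OF W]
    by (auto simp: has_polar_derivs_def)
  have int: "integrable lebesgue (\<lambda>x. f x / (norm x)\<^sup>2)" if "supported_away K f" for f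
    using supported_away_integrable[OF K that] .
  have "integrable lebesgue (\<lambda>x. (wEE x + 2 * m * wE x + m\<^sup>2 * w x + wRR x)\<^sup>2 / (norm x)\<^sup>2)"
    by (intro int) (auto simp: supported_away_def supps intro!: continuous_intros conts)
  then show "integrable lebesgue (\<lambda>x. (classical_L m u x)\<^sup>2)" by (simp only: L)
  have "integrable lebesgue (\<lambda>x. \<phi> x * (w x)\<^sup>2 / (norm x)\<^sup>2)"
    by (intro int) (auto simp: supported_away_def supps intro!: continuous_intros conts)
  then show "integrable lebesgue (\<lambda>x. c * norm x powr \<sigma> * (u x)\<^sup>2 / norm x ^ 4)"
    by (simp only: Q) (simp only: \<phi>_def)
  have "integrable lebesgue (\<lambda>x. \<phi> x * ((w x + wE x)\<^sup>2 + (wR x)\<^sup>2) / (norm x)\<^sup>2)"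
    by (intro int) (auto simp: supported_away_def supps intro!: continuous_intros conts)
  then show "integrable lebesgue (\<lambda>x. c * norm x powr \<sigma> * ((partial 1 u x)\<^sup>2 + (partial 2 u x)\<^sup>2) / (norm x)\<^sup>2)"
    by (simp only: G) (simp only: \<phi>_def p_def)
  have \<phi>_bounds: "0 \<le> \<phi> x" "\<phi> x \<le> 1" if "x \<in> K" for x
    using c(1) c(2)[OF that] by (simp_all add: \<phi>_def)
  let ?P = "polar_integral (\<lambda>x. (wEE x + 2 * m * wE x + m\<^sup>2 * w x + wRR x)\<^sup>2)"
  have "polar_integral (\<lambda>x. \<phi> x * (w x)\<^sup>2) \<le> 1 / (\<sigma>\<^sup>2 * m\<^sup>2) * ?P"
    "polar_integral (\<lambda>x. \<phi> x * ((w x + wE x)\<^sup>2 + (wR x)\<^sup>2)) \<le>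
      ((5 / 2 + \<bar>\<sigma>\<bar> / 2 + m\<^sup>2) / (\<sigma>\<^sup>2 * m\<^sup>2) + 1 / 2 + (\<bar>\<sigma>\<bar> / 2 + 2) / (4 * m\<^sup>2)) * ?P"
    by (rule polar_energy_estimate[OF K _ W WE WR \<phi> _ _ m \<sigma>]; simp add: supps \<phi>_bounds)+
  note est = this[unfolded polar_integral_def L Q G]
  have nn: "0 \<le> (LINT x|lebesgue. (classical_L m u x)\<^sup>2)" by simp
  have "1 / (\<sigma>\<^sup>2 * m\<^sup>2) \<le> energy_const m \<bar>\<sigma>\<bar>"
  proof -
    have "1 / (\<sigma>\<^sup>2 * m\<^sup>2) \<le> (5 / 2 + \<bar>\<sigma>\<bar> / 2 + m\<^sup>2) / (\<sigma>\<^sup>2 * m\<^sup>2)"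
    proof (rule divide_right_mono)
      show "1 \<le> 5 / 2 + \<bar>\<sigma>\<bar> / 2 + m\<^sup>2"
        using zero_le_power2[of m] abs_ge_zero[of \<sigma>] by linarith
    qed simp
    moreover have "0 \<le> (\<bar>\<sigma>\<bar> / 2 + 2) / (4 * m\<^sup>2)" by simp
    ultimately show ?thesis unfolding energy_const_def power2_abs by linarith
  qed
  from order_trans[OF est(1) mult_right_mono[OF this nn]]
  show "(LINT x|lebesgue. c * norm x powr \<sigma> * (u x)\<^sup>2 / norm x ^ 4)
      \<le> energy_const m \<bar>\<sigma>\<bar> * (LINT x|lebesgue. (classical_L m u x)\<^sup>2)"
    by (simp only: \<phi>_def)
  from est(2)
  show "(LINT x|lebesgue. c * norm x powr \<sigma> * ((partial 1 u x)\<^sup>2 + (partial 2 u x)\<^sup>2) / (norm x)\<^sup>2)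
      \<le> energy_const m \<bar>\<sigma>\<bar> * (LINT x|lebesgue. (classical_L m u x)\<^sup>2)"
    by (simp only: \<phi>_def p_def energy_const_def power2_abs)
qed

section \<open>Approximation by test functions\<close>

context
  fixes \<Omega> :: "(real ^ 'n::finite) set"
  assumes \<Omega>: "open \<Omega>"
begin

lemma open_lebesgue: "\<Omega> \<inter> space lebesgue \<in> sets lebesgue"
  using \<Omega> by simp

lemma L2_iff:
  "f \<in> L2 \<Omega> \<longleftrightarrow> f \<in> borel_measurable (lebesgue_on \<Omega>) \<and> integrable (lebesgue_on \<Omega>) (\<lambda>x. (f x)\<^sup>2)"
  using open_lebesgue
  by (simp add: L2_def set_borel_measurable_def set_integrable_def
      borel_measurable_restrict_space_iff integrable_restrict_space)

lemma set_integral_lebesgue_on: "(LINT x:\<Omega>|lebesgue. f x) = (LINT x|lebesgue_on \<Omega>. f x)"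
  for f :: "real ^ 'n \<Rightarrow> real"
  using open_lebesgue by (simp add: integral_restrict_space set_lebesgue_integral_def)

lemma AE_lebesgue_on: "(AE x\<in>\<Omega> in lebesgue. P x) \<longleftrightarrow> (AE x in lebesgue_on \<Omega>. P x)"
  using open_lebesgue by (simp add: AE_restrict_space_iff)

lemma continuous_measurable_lebesgue_on:
  fixes f :: "real ^ 'n \<Rightarrow> real"
  assumes "continuous_on UNIV f" shows "f \<in> borel_measurable (lebesgue_on \<Omega>)"
  using borel_measurable_continuous_onI[OF assms]
  by (simp add: measurable_completion measurable_restrict_space1)

lemma L2_diff:
  assumes "f \<in> L2 \<Omega>" "g \<in> L2 \<Omega>" shows "(\<lambda>x. f x - g x) \<in> L2 \<Omega>"
proof -
  note [measurable] = assms[unfolded L2_iff, THEN conjunct1]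
  have "integrable (lebesgue_on \<Omega>) (\<lambda>x. 2 * (f x)\<^sup>2 + 2 * (g x)\<^sup>2)"
    using assms by (simp add: L2_iff)
  then have "integrable (lebesgue_on \<Omega>) (\<lambda>x. (f x - g x)\<^sup>2)"
  proof (rule Bochner_Integration.integrable_bound)
    show "AE x in lebesgue_on \<Omega>. norm ((f x - g x)\<^sup>2) \<le> norm (2 * (f x)\<^sup>2 + 2 * (g x)\<^sup>2)"
    proof (rule AE_I2)
      fix x
      have "(f x - g x)\<^sup>2 \<le> 2 * (f x)\<^sup>2 + 2 * (g x)\<^sup>2"
        using zero_le_power2[of "f x + g x"] by (simp add: power2_sum power2_diff)
      then show "norm ((f x - g x)\<^sup>2) \<le> norm (2 * (f x)\<^sup>2 + 2 * (g x)\<^sup>2)"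
        by simp
    qed
  qed measurable
  then show ?thesis by (simp add: L2_iff)
qed

lemma L2_cong_AE:
  assumes f: "f \<in> L2 \<Omega>" and ae: "AE x in lebesgue_on \<Omega>. f x = g x" shows "g \<in> L2 \<Omega>"
proof -
  have "(\<lambda>x. indicator \<Omega> x *\<^sub>R g x) \<in> borel_measurable lebesgue"
  proof (rule borel_measurable_completion_cong_AE)
    show "(\<lambda>x. indicator \<Omega> x *\<^sub>R f x) \<in> borel_measurable lebesgue"
      using f by (simp add: L2_def set_borel_measurable_def)
    show "AE x in lebesgue. indicator \<Omega> x *\<^sub>R f x = indicator \<Omega> x *\<^sub>R g x"
      using ae unfolding AE_lebesgue_on[symmetric] by eventually_elim (auto simp: indicator_def)
  qed
  then have [measurable]: "g \<in> borel_measurable (lebesgue_on \<Omega>)"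
    using open_lebesgue by (simp add: borel_measurable_restrict_space_iff)
  have "integrable (lebesgue_on \<Omega>) (\<lambda>x. (g x)\<^sup>2)"
  proof (rule integrable_cong_AE_imp)
    show "integrable (lebesgue_on \<Omega>) (\<lambda>x. (f x)\<^sup>2)" using f by (simp add: L2_iff)
    show "AE x in lebesgue_on \<Omega>. (f x)\<^sup>2 = (g x)\<^sup>2"
      using ae by eventually_elim simp
  qed measurable
  then show ?thesis by (simp add: L2_iff)
qed

lemma test_function_L2:
  assumes "\<phi> \<in> test_functions \<Omega>" shows "\<phi> \<in> L2 \<Omega>"
proof -
  from assms obtain K where K: "compact K" "K \<subseteq> \<Omega>" "\<And>x. x \<notin> K \<Longrightarrow> \<phi> x = 0" "smooth \<phi>"
    by (rule test_functionsE) blast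
  have "integrable lebesgue (\<lambda>x. (\<phi> x)\<^sup>2)"
    by (rule integrable_continuous_on_compact_support[OF K(1)
          continuous_on_power[OF smooth_continuous_on[OF K(4)]]]) (simp add: K(3))
  then have "integrable (lebesgue_on \<Omega>) (\<lambda>x. (\<phi> x)\<^sup>2)"
    using integrable_mult_indicator[of \<Omega> lebesgue "\<lambda>x. (\<phi> x)\<^sup>2"] open_lebesgue by (simp add: integrable_restrict_space)
  then show ?thesis
    using continuous_measurable_lebesgue_on[OF smooth_continuous_on[OF K(4)]] by (simp add: L2_iff)
qed

text \<open>\<open>W22_norm\<close> uses the partials chosen for u - \<phi>, whereas the estimate
  needs the partials chosen for u minus those of \<phi>. Uniqueness identifies them almost
  everywhere, at both orders, and a single integral then controls all errors.\<close>

lemma W22_0_approx: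
  fixes u :: "real ^ 'n \<Rightarrow> real"
  assumes u: "u \<in> W22_0 \<Omega>" and \<epsilon>: "\<epsilon> > 0"
  obtains \<phi> where "\<phi> \<in> test_functions \<Omega>"
    "(\<integral>\<^sup>+x. ennreal ((u x - \<phi> x)\<^sup>2 + (\<Sum>i\<in>UNIV. (weak_partial \<Omega> i u x - partial i \<phi> x)\<^sup>2) +
       (\<Sum>i\<in>UNIV. \<Sum>j\<in>UNIV. (weak_partial \<Omega> j (weak_partial \<Omega> i u) x - partial j (partial i \<phi>) x)\<^sup>2))
       \<partial>lebesgue_on \<Omega>) \<le> ennreal \<epsilon>"
proof -
  \<comment> \<open>The norm is the square root of the integral to be bounded, hence sqrt
    \<epsilon>.\<close>
  obtain \<phi> where \<phi>: "\<phi> \<in> test_functions \<Omega>" and small: "W22_norm \<Omega> (\<lambda>x. u x - \<phi> x) < sqrt \<epsilon>"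
    using u \<epsilon> unfolding W22_0_def by (auto dest!: spec[of _ "sqrt \<epsilon>"])
  have smooth: "smooth \<phi>" using \<phi> by (simp add: test_functions_def)
  define v where "v = (\<lambda>x. u x - \<phi> x)"
  define p where "p i = weak_partial \<Omega> i u" for i
  define q where "q i j = weak_partial \<Omega> j (p i)" for i j
  have W: "u \<in> L2 \<Omega>" "\<And>i. p i \<in> L2 \<Omega>" "\<And>i j. q i j \<in> L2 \<Omega>"
    "\<And>i. weakly_differentiable \<Omega> i u" "\<And>i j. weakly_differentiable \<Omega> j (p i)"
    using u by (auto simp: W22_0_def W22_def p_def q_def)
  have wd: "has_weak_partial \<Omega> i f (weak_partial \<Omega> i f)" if "weakly_differentiable \<Omega> i f" for i f
  proof -
    from that obtain v where "has_weak_partial \<Omega> i f v"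
      by (auto simp: weakly_differentiable_def)
    then show ?thesis by (rule has_weak_partial_weak_partial)
  qed
  have p: "has_weak_partial \<Omega> i u (p i)" for i
    unfolding p_def by (rule wd[OF W(4)])
  have q: "has_weak_partial \<Omega> j (p i) (q i j)" for i j
    unfolding q_def by (rule wd[OF W(5)])
  have dv: "has_weak_partial \<Omega> i v (\<lambda>x. p i x - partial i \<phi> x)" for i
    unfolding v_def by (intro has_weak_partial_diff p has_weak_partial_smooth smooth)
  note ae1 = weak_partial_AE_eq[OF \<Omega> dv]
  have "has_weak_partial \<Omega> j (\<lambda>x. p i x - partial i \<phi> x) (\<lambda>x. q i j x - partial j (partial i \<phi>) x)" for i j
    by (intro has_weak_partial_diff q has_weak_partial_smooth smooth_partial smooth)
  \<comment> \<open>The norm differentiates the chosen first partial of v, so the explicit one is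
    exchanged for it before second derivatives are compared.\<close>
  then have ddv: "has_weak_partial \<Omega> j (weak_partial \<Omega> i v) (\<lambda>x. q i j x - partial j (partial i \<phi>) x)" for i j
  proof (rule has_weak_partial_cong_AE[OF \<Omega>, rotated])
    show "AE x\<in>\<Omega> in lebesgue. p i x - partial i \<phi> x = weak_partial \<Omega> i v x"
      using ae1[of i] by eventually_elim simp
  qed
  note ae2 = weak_partial_AE_eq[OF \<Omega> ddv]
  have L: "v \<in> L2 \<Omega>" "(\<lambda>x. p i x - partial i \<phi> x) \<in> L2 \<Omega>" "(\<lambda>x. q i j x - partial j (partial i \<phi>) x) \<in> L2 \<Omega>" for i j
    unfolding v_def by (intro L2_diff W test_function_L2 test_functions_partial \<phi>)+
  have L': "weak_partial \<Omega> i v \<in> L2 \<Omega>" "weak_partial \<Omega> j (weak_partial \<Omega> i v) \<in> L2 \<Omega>" for i j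
  proof -
    have "AE x in lebesgue_on \<Omega>. p i x - partial i \<phi> x = weak_partial \<Omega> i v x"
      using ae1[of i] unfolding AE_lebesgue_on by eventually_elim simp
    with L(2) show "weak_partial \<Omega> i v \<in> L2 \<Omega>" by (rule L2_cong_AE)
    have "AE x in lebesgue_on \<Omega>. q i j x - partial j (partial i \<phi>) x = weak_partial \<Omega> j (weak_partial \<Omega> i v) x"
      using ae2[of j i] unfolding AE_lebesgue_on by eventually_elim simp
    with L(3) show "weak_partial \<Omega> j (weak_partial \<Omega> i v) \<in> L2 \<Omega>" by (rule L2_cong_AE)
  qed
  let ?e = "\<lambda>x. (v x)\<^sup>2 + (\<Sum>i\<in>UNIV. (weak_partial \<Omega> i v x)\<^sup>2) + (\<Sum>i\<in>UNIV. \<Sum>j\<in>UNIV. (weak_partial \<Omega> j (weak_partial \<Omega> i v) x)\<^sup>2)"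
  have int: "integrable (lebesgue_on \<Omega>) ?e"
    using L(1) L' by (intro Bochner_Integration.integrable_add Bochner_Integration.integrable_sum) (auto simp: L2_iff)
  have "W22_norm \<Omega> v = sqrt (LINT x|lebesgue_on \<Omega>. ?e x)"
    using L(1) L' unfolding W22_norm_def set_integral_lebesgue_on by (simp add: L2_iff)
  with small have "(LINT x|lebesgue_on \<Omega>. ?e x) \<le> \<epsilon>"
    unfolding v_def by simp
  moreover have "AE x in lebesgue_on \<Omega>. \<forall>i. weak_partial \<Omega> i v x = p i x - partial i \<phi> x"
    using ae1 unfolding AE_lebesgue_on by (simp add: AE_all_countable)
  moreover have "AE x in lebesgue_on \<Omega>. \<forall>i j. weak_partial \<Omega> j (weak_partial \<Omega> i v) x = q i j x - partial j (partial i \<phi>) x"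
    using ae2 unfolding AE_lebesgue_on by (simp add: AE_all_countable)
  ultimately have "(\<integral>\<^sup>+x. ennreal ((u x - \<phi> x)\<^sup>2 + (\<Sum>i\<in>UNIV. (p i x - partial i \<phi> x)\<^sup>2) +
       (\<Sum>i\<in>UNIV. \<Sum>j\<in>UNIV. (q i j x - partial j (partial i \<phi>) x)\<^sup>2)) \<partial>lebesgue_on \<Omega>) \<le> ennreal \<epsilon>"
  proof -
    assume e: "(LINT x|lebesgue_on \<Omega>. ?e x) \<le> \<epsilon>"
    assume "AE x in lebesgue_on \<Omega>. \<forall>i. weak_partial \<Omega> i v x = p i x - partial i \<phi> x"
      "AE x in lebesgue_on \<Omega>. \<forall>i j. weak_partial \<Omega> j (weak_partial \<Omega> i v) x = q i j x - partial j (partial i \<phi>) x"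
    then have "AE x in lebesgue_on \<Omega>. ennreal ((u x - \<phi> x)\<^sup>2 + (\<Sum>i\<in>UNIV. (p i x - partial i \<phi> x)\<^sup>2) +
       (\<Sum>i\<in>UNIV. \<Sum>j\<in>UNIV. (q i j x - partial j (partial i \<phi>) x)\<^sup>2)) = ennreal (?e x)"
      by eventually_elim (simp add: v_def)
    then have "(\<integral>\<^sup>+x. ennreal ((u x - \<phi> x)\<^sup>2 + (\<Sum>i\<in>UNIV. (p i x - partial i \<phi> x)\<^sup>2) +
       (\<Sum>i\<in>UNIV. \<Sum>j\<in>UNIV. (q i j x - partial j (partial i \<phi>) x)\<^sup>2)) \<partial>lebesgue_on \<Omega>) =
       (\<integral>\<^sup>+x. ennreal (?e x) \<partial>lebesgue_on \<Omega>)"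
      by (rule nn_integral_cong_AE)
    also have "\<dots> = ennreal (LINT x|lebesgue_on \<Omega>. ?e x)"
      by (intro nn_integral_eq_integral int AE_I2 add_nonneg_nonneg sum_nonneg) auto
    also have "\<dots> \<le> ennreal \<epsilon>" using e by (rule ennreal_leI)
    finally show ?thesis .
  qed
  then show ?thesis
    using \<phi> that unfolding p_def q_def by blast
qed

end

section \<open>Weights on the annulus and passage to \<open>W22_0\<close>\<close>

lemma annulus_open: "open (annulus a b)"
  unfolding annulus_def by (intro open_Diff) auto

lemma annulus_norm:
  assumes "0 < a" "x \<in> annulus a b"
  shows "a < norm x" "norm x < b"
  using assms by (auto simp: annulus_def closure_ball)

lemma powr_weight_eq:
  assumes "0 < a" "a < norm x" "norm x < b"
  shows "(norm x / b) powr \<alpha> = b powr - \<alpha> * norm x powr \<alpha>"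
    and "(a / norm x) powr \<alpha> = a powr \<alpha> * norm x powr - \<alpha>"
proof -
  have "0 < norm x" "0 < b" using assms by linarith+
  then show "(norm x / b) powr \<alpha> = b powr - \<alpha> * norm x powr \<alpha>"
    "(a / norm x) powr \<alpha> = a powr \<alpha> * norm x powr - \<alpha>"
    using assms(1) by (simp_all add: powr_divide powr_minus_divide)
qed

lemma powr_weight_le_1:
  assumes "0 < a" "a < norm x" "norm x < b" "\<alpha> > 0"
  shows "(norm x / b) powr \<alpha> \<le> 1" "(a / norm x) powr \<alpha> \<le> 1"
proof -
  have "0 < norm x" "0 < b" using assms by linarith+
  then show "(norm x / b) powr \<alpha> \<le> 1" "(a / norm x) powr \<alpha> \<le> 1"
    using assms by (auto intro!: powr_le1)
qed

text \<open>On the annulus each weight is a constant times a power of |x|, bounded by 1.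
  \<open>smooth_estimate\<close> is applied to each of the two, and adding the results produces the
  factor 2.\<close>

lemma test_function_estimate:
  assumes a: "0 < a" and \<phi>: "\<phi> \<in> test_functions (annulus a b)" and m: "m > 0" and \<alpha>: "\<alpha> > 0"
  defines "W \<equiv> \<lambda>x::real^2. (norm x / b) powr \<alpha> + (a / norm x) powr \<alpha>"
    and "J \<equiv> \<lambda>f. \<integral>\<^sup>+x. ennreal (f x) \<partial>lebesgue_on (annulus a b)"
  shows "J (\<lambda>x. (\<phi> x)\<^sup>2 / norm x ^ 4 * W x)
      \<le> ennreal (2 * energy_const m \<alpha>) * J (\<lambda>x. (classical_L m \<phi> x)\<^sup>2)"
    and "J (\<lambda>x. ((partial 1 \<phi> x)\<^sup>2 + (partial 2 \<phi> x)\<^sup>2) / (norm x)\<^sup>2 * W x)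
      \<le> ennreal (2 * energy_const m \<alpha>) * J (\<lambda>x. (classical_L m \<phi> x)\<^sup>2)"
proof -
  let ?\<Omega> = "annulus a b"
  let ?c = "energy_const m \<alpha>"
  from \<phi> obtain K where K: "compact K" "K \<subseteq> ?\<Omega>" "\<And>x. x \<notin> K \<Longrightarrow> \<phi> x = 0" "smooth \<phi>"
    by (rule test_functionsE) blast
  have norms: "a < norm x" "norm x < b" if "x \<in> K" for x
    using annulus_norm[OF a] K(2) that by blast+
  have 0: "0 \<notin> K" using norms[of 0] a by auto
  let ?w1 = "\<lambda>x::real^2. b powr - \<alpha> * norm x powr \<alpha>" and ?w2 = "\<lambda>x::real^2. a powr \<alpha> * norm x powr - \<alpha>"
  have c1: "?w1 x \<le> 1" and c2: "?w2 x \<le> 1" if "x \<in> K" for x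
    using powr_weight_le_1[OF a norms[OF that] \<alpha>] powr_weight_eq[OF a norms[OF that], of \<alpha>] by simp_all
  have e1: "\<bar>\<alpha>\<bar> = \<alpha>" "\<bar>- \<alpha>\<bar> = \<alpha>" and ne: "\<alpha> \<noteq> 0" "- \<alpha> \<noteq> 0" using \<alpha> by auto
  note est1 = smooth_estimate[OF K(1) 0 K(3,4) m ne(1) powr_ge_zero c1, unfolded e1]
  note est2 = smooth_estimate[OF K(1) 0 K(3,4) m ne(2) powr_ge_zero c2, unfolded e1]
  have p0: "partial i \<phi> x = 0" if "x \<notin> K" for i x
    by (rule partial_zero_outside[OF K(3) compact_imp_closed[OF K(1)] that])
  have pp0: "partial j (partial i \<phi>) x = 0" if "x \<notin> K" for i j x
    by (rule partial_zero_outside[OF p0 compact_imp_closed[OF K(1)] that])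
  \<comment> \<open>The integrands f and g need agree only on the annulus, because the weights are
    rewritten as powers only there; outside, g is 0 by the support of \<phi>.\<close>
  have J: "J f = ennreal (LINT x|lebesgue. g x)"
    if "integrable lebesgue g" "\<And>x. x \<in> ?\<Omega> \<Longrightarrow> f x = g x" "\<And>x. 0 \<le> g x" "\<And>x. x \<notin> K \<Longrightarrow> g x = 0" for f g
  proof -
    have "J f = (\<integral>\<^sup>+x\<in>?\<Omega>. ennreal (f x) \<partial>lebesgue)"
      unfolding J_def using open_lebesgue[OF annulus_open] by (rule nn_integral_restrict_space)
    also have "\<dots> = (\<integral>\<^sup>+x. ennreal (g x) \<partial>lebesgue)"
    proof (rule nn_integral_cong)
      fix x
      have "x \<notin> K" if "x \<notin> ?\<Omega>" using K(2) that by blast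
      then show "ennreal (f x) * indicator ?\<Omega> x = ennreal (g x)"
        using that(2,4)[of x] by (cases "x \<in> ?\<Omega>") simp_all
    qed
    also have "\<dots> = ennreal (LINT x|lebesgue. g x)"
      using that(1,3) by (intro nn_integral_eq_integral) auto
    finally show ?thesis .
  qed
  have JL: "J (\<lambda>x. (classical_L m \<phi> x)\<^sup>2) = ennreal (LINT x|lebesgue. (classical_L m \<phi> x)\<^sup>2)"
    by (rule J[OF est1(1)]) (auto simp: classical_L_def K(3) p0 pp0)
  have W: "W x = ?w1 x + ?w2 x" if "x \<in> ?\<Omega>" for x
    using powr_weight_eq[OF a annulus_norm[OF a that]] by (simp add: W_def)
  have c0: "0 \<le> ?c" using \<alpha> by (simp add: energy_const_def)
  have "J (\<lambda>x. (\<phi> x)\<^sup>2 / norm x ^ 4 * W x) =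
      ennreal (LINT x|lebesgue. ?w1 x * (\<phi> x)\<^sup>2 / norm x ^ 4 + ?w2 x * (\<phi> x)\<^sup>2 / norm x ^ 4)"
    by (rule J[OF Bochner_Integration.integrable_add[OF est1(2) est2(2)]])
       (auto simp: W K(3) distrib_left add_divide_distrib mult.commute)
  also have "\<dots> \<le> ennreal (2 * ?c * (LINT x|lebesgue. (classical_L m \<phi> x)\<^sup>2))"
    using add_mono[OF est1(4) est2(4)]
    by (intro ennreal_leI) (simp add: Bochner_Integration.integral_add[OF est1(2) est2(2)])
  finally show "J (\<lambda>x. (\<phi> x)\<^sup>2 / norm x ^ 4 * W x) \<le> ennreal (2 * ?c) * J (\<lambda>x. (classical_L m \<phi> x)\<^sup>2)"
    unfolding JL using c0 by (simp add: ennreal_mult)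
  have "J (\<lambda>x. ((partial 1 \<phi> x)\<^sup>2 + (partial 2 \<phi> x)\<^sup>2) / (norm x)\<^sup>2 * W x) =
      ennreal (LINT x|lebesgue. ?w1 x * ((partial 1 \<phi> x)\<^sup>2 + (partial 2 \<phi> x)\<^sup>2) / (norm x)\<^sup>2
        + ?w2 x * ((partial 1 \<phi> x)\<^sup>2 + (partial 2 \<phi> x)\<^sup>2) / (norm x)\<^sup>2)"
    by (rule J[OF Bochner_Integration.integrable_add[OF est1(3) est2(3)]])
       (auto simp: W p0 distrib_left add_divide_distrib[symmetric] mult.commute)
  also have "\<dots> \<le> ennreal (2 * ?c * (LINT x|lebesgue. (classical_L m \<phi> x)\<^sup>2))"
    using add_mono[OF est1(5) est2(5)]
    by (intro ennreal_leI) (simp add: Bochner_Integration.integral_add[OF est1(3) est2(3)])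
  finally show "J (\<lambda>x. ((partial 1 \<phi> x)\<^sup>2 + (partial 2 \<phi> x)\<^sup>2) / (norm x)\<^sup>2 * W x)
      \<le> ennreal (2 * ?c) * J (\<lambda>x. (classical_L m \<phi> x)\<^sup>2)"
    unfolding JL using c0 by (simp add: ennreal_mult)
qed

lemma nn_integral_le_linear_combination:
  fixes f g h :: "'a \<Rightarrow> real"
  assumes [measurable]: "g \<in> borel_measurable M" "h \<in> borel_measurable M"
    and le: "\<And>x. x \<in> space M \<Longrightarrow> f x \<le> c * g x + d * h x"
    and nonneg: "0 \<le> c" "0 \<le> d" "\<And>x. x \<in> space M \<Longrightarrow> 0 \<le> g x" "\<And>x. x \<in> space M \<Longrightarrow> 0 \<le> h x"
  shows "(\<integral>\<^sup>+x. ennreal (f x) \<partial>M) \<le> ennreal c * (\<integral>\<^sup>+x. ennreal (g x) \<partial>M) + ennreal d * (\<integral>\<^sup>+x. ennreal (h x) \<partial>M)"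
proof -
  have "(\<integral>\<^sup>+x. ennreal (f x) \<partial>M) \<le> (\<integral>\<^sup>+x. ennreal c * ennreal (g x) + ennreal d * ennreal (h x) \<partial>M)"
  proof (rule nn_integral_mono)
    fix x assume x: "x \<in> space M"
    have "ennreal (f x) \<le> ennreal (c * g x + d * h x)"
      by (rule ennreal_leI[OF le[OF x]])
    then show "ennreal (f x) \<le> ennreal c * ennreal (g x) + ennreal d * ennreal (h x)"
      using nonneg x by (simp add: ennreal_mult)
  qed
  also have "\<dots> = ennreal c * (\<integral>\<^sup>+x. ennreal (g x) \<partial>M) + ennreal d * (\<integral>\<^sup>+x. ennreal (h x) \<partial>M)"
    by (simp add: nn_integral_add nn_integral_cmult)
  finally show ?thesis .
qed

text \<open>Here E is the approximation error, X and Y are the weighted integral and the energy of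
  the approximant. Chaining the bounds leaves 2 * c * 2 times B plus a multiple of \<epsilon>, which
  tends to 0. In \<open>ennreal\<close> the case of infinite B is included.\<close>

lemma ennreal_le_absorb_error:
  assumes nonneg: "0 \<le> k" "0 \<le> l" "0 \<le> c"
    and approx: "\<And>\<epsilon>. \<epsilon> > 0 \<Longrightarrow> \<exists>E X Y. E \<le> ennreal \<epsilon> \<and> A \<le> ennreal k * E + ennreal 2 * X \<and>
        X \<le> ennreal c * Y \<and> Y \<le> ennreal 2 * B + ennreal l * E"
  shows "A \<le> ennreal (4 * c) * B"
proof (rule ennreal_le_epsilon)
  fix \<delta> :: real assume \<delta>: "0 < \<delta>"
  \<comment> \<open>The total coefficient of the error is k + 2 c l; adding 1 keeps the divisor
    positive.\<close>
  define s where "s = k + 2 * c * l + 1"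
  have s: "s > 0" using nonneg by (simp add: s_def add_nonneg_pos)
  obtain E X Y where E: "E \<le> ennreal (\<delta> / s)" and A: "A \<le> ennreal k * E + ennreal 2 * X"
    and X: "X \<le> ennreal c * Y" and Y: "Y \<le> ennreal 2 * B + ennreal l * E"
    using approx[of "\<delta> / s"] \<delta> s by auto
  have "A \<le> ennreal k * E + ennreal 2 * (ennreal c * (ennreal 2 * B + ennreal l * E))"
    using A X Y by (meson add_left_mono mult_left_mono order_trans zero_le)
  also have "\<dots> \<le> ennreal k * ennreal (\<delta> / s) + ennreal 2 * (ennreal c * (ennreal 2 * B + ennreal l * ennreal (\<delta> / s)))"
    by (intro add_mono mult_left_mono E) auto
  also have "\<dots> = ennreal 2 * ennreal c * ennreal 2 * B + (ennreal k * ennreal (\<delta> / s) + ennreal 2 * ennreal c * ennreal l * ennreal (\<delta> / s))"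
    by (simp add: distrib_left ac_simps)
  also have "\<dots> = ennreal (4 * c) * B + ennreal ((k + 2 * c * l) * (\<delta> / s))"
  proof -
    have d: "0 \<le> \<delta> / s" using \<delta> s by simp
    have "4 * c = 2 * c * 2" by simp
    then have "ennreal (4 * c) = ennreal 2 * ennreal c * ennreal 2"
      using nonneg by (simp only: ennreal_mult mult_nonneg_nonneg zero_le_numeral)
    moreover have "ennreal ((k + 2 * c * l) * (\<delta> / s)) =
        ennreal k * ennreal (\<delta> / s) + ennreal 2 * ennreal c * ennreal l * ennreal (\<delta> / s)"
      using nonneg d by (simp only: distrib_right ennreal_plus ennreal_mult mult_nonneg_nonneg zero_le_numeral)
    ultimately show ?thesis by simp
  qed
  also have "\<dots> \<le> ennreal (4 * c) * B + ennreal \<delta>"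
    using nonneg \<delta> s by (intro add_left_mono ennreal_leI) (simp add: s_def field_simps)
  finally show "A \<le> ennreal (4 * c) * B + ennreal \<delta>" .
qed

text \<open>Lagrange's identity for the coefficient vector (1, 1, c, d, e), whose ten squares are
  listed in the proof. The five slots are the two pure second derivatives, the two first derivatives
  and u in L_m; c^2 + d^2 is grouped because the drift coefficients are estimated together.\<close>

lemma Cauchy_Schwarz_5:
  fixes p q r s t c d e :: real
  shows "(p + q + c * r + d * s + e * t)\<^sup>2 \<le> (2 + (c\<^sup>2 + d\<^sup>2) + e\<^sup>2) * (p\<^sup>2 + q\<^sup>2 + r\<^sup>2 + s\<^sup>2 + t\<^sup>2)"
proof -
  have "(2 + (c\<^sup>2 + d\<^sup>2) + e\<^sup>2) * (p\<^sup>2 + q\<^sup>2 + r\<^sup>2 + s\<^sup>2 + t\<^sup>2) - (p + q + c * r + d * s + e * t)\<^sup>2 =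
    (p - q)\<^sup>2 + (r - c * p)\<^sup>2 + (s - d * p)\<^sup>2 + (t - e * p)\<^sup>2 + (r - c * q)\<^sup>2 + (s - d * q)\<^sup>2 + (t - e * q)\<^sup>2
      + (c * s - d * r)\<^sup>2 + (c * t - e * r)\<^sup>2 + (d * t - e * s)\<^sup>2"
    by (simp add: power2_eq_square algebra_simps)
  also have "\<dots> \<ge> 0" by simp
  finally show ?thesis by simp
qed

lemma square_le_2_diff_square: "(y::real)\<^sup>2 \<le> 2 * z\<^sup>2 + 2 * (y - z)\<^sup>2"
  using zero_le_power2[of "y - 2 * z"] by (simp add: power2_eq_square algebra_simps)

lemma L_op_eq:
  "L_op m \<Omega> u x = weak_partial \<Omega> 1 (weak_partial \<Omega> 1 u) x + weak_partial \<Omega> 2 (weak_partial \<Omega> 2 u) x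
     + 2 * (m - 1) * ((x $ 1 * weak_partial \<Omega> 1 u x + x $ 2 * weak_partial \<Omega> 2 u x) / (norm x)\<^sup>2)
     + (m - 1)\<^sup>2 / (norm x)\<^sup>2 * u x"
  by (simp add: L_op_def weak_laplacian_def weak_gradient_def inner_2 sum_2 divide_inverse algebra_simps)

text \<open>Replacing u by a test function costs multiples of the error integral that depend on a.
  They do not reach the constant, since the error is sent to 0 for fixed a and b.\<close>

lemma W22_0_estimate:
  fixes m \<alpha> a b :: real and u :: "real ^ 2 \<Rightarrow> real"
  assumes m: "m > 1" and \<alpha>: "\<alpha> > 0" and a: "0 < a" and u: "u \<in> W22_0 (annulus a b)"
  defines "W \<equiv> \<lambda>x::real^2. (norm x / b) powr \<alpha> + (a / norm x) powr \<alpha>"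
    and "J \<equiv> \<lambda>f. \<integral>\<^sup>+x. ennreal (f x) \<partial>lebesgue_on (annulus a b)"
  shows "J (\<lambda>x. (u x)\<^sup>2 / norm x ^ 4 * W x)
      \<le> ennreal (8 * energy_const m \<alpha>) * J (\<lambda>x. (L_op m (annulus a b) u x)\<^sup>2)"
    and "J (\<lambda>x. (norm (weak_gradient (annulus a b) u x))\<^sup>2 / (norm x)\<^sup>2 * W x)
      \<le> ennreal (8 * energy_const m \<alpha>) * J (\<lambda>x. (L_op m (annulus a b) u x)\<^sup>2)"
proof -
  let ?\<Omega> = "annulus a b"
  let ?c = "2 * energy_const m \<alpha>"
  have m0: "m > 0" using m by simp
  have c: "0 \<le> ?c" using \<alpha> by (simp add: energy_const_def)
  define p where "p = (\<lambda>i. weak_partial ?\<Omega> i u)"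
  define q where "q = (\<lambda>i j. weak_partial ?\<Omega> j (p i))"
  have "u \<in> L2 ?\<Omega>" "\<And>i. p i \<in> L2 ?\<Omega>" "\<And>i j. q i j \<in> L2 ?\<Omega>"
    using u by (auto simp: W22_0_def W22_def p_def q_def)
  then have meas [measurable]: "u \<in> borel_measurable (lebesgue_on ?\<Omega>)" "p i \<in> borel_measurable (lebesgue_on ?\<Omega>)"
    "q i j \<in> borel_measurable (lebesgue_on ?\<Omega>)" for i j
    by (simp_all add: L2_iff[OF annulus_open])
  have [measurable]: "(\<lambda>x. norm x) \<in> borel_measurable (lebesgue_on ?\<Omega>)" "(\<lambda>x. x $ i) \<in> borel_measurable (lebesgue_on ?\<Omega>)" for i
    by (auto intro!: continuous_measurable_lebesgue_on continuous_intros annulus_open)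
  have W [measurable]: "W \<in> borel_measurable (lebesgue_on ?\<Omega>)"
    unfolding W_def by measurable
  have L [measurable]: "L_op m ?\<Omega> u \<in> borel_measurable (lebesgue_on ?\<Omega>)"
    unfolding L_op_eq[abs_def] p_def[symmetric] using meas by (simp add: q_def p_def) measurable
  have W_bounds: "0 \<le> W x" "W x \<le> 2" if "x \<in> ?\<Omega>" for x
    using powr_weight_le_1[OF a annulus_norm[OF a that] \<alpha>] by (simp_all add: W_def)
  \<comment> \<open>Twice the factor of \<open>Cauchy_Schwarz_5\<close>, with the coefficients of
    L_m bounded by means of |x| > a.\<close>
  define l where "l = 2 * (2 + 4 * (m - 1)\<^sup>2 / a\<^sup>2 + (m - 1) ^ 4 / a ^ 4)"
  have l: "0 \<le> l" using a by (simp add: l_def)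
  have grad: "(norm (weak_gradient ?\<Omega> u x))\<^sup>2 = (p 1 x)\<^sup>2 + (p 2 x)\<^sup>2" for x
    by (simp add: norm_sq_2 weak_gradient_def p_def)
  \<comment> \<open>One test function serves both inequalities: X1 and X2 are its two weighted
    integrals, Y its energy, and E the error.\<close>
  have approx: "\<exists>E X1 X2 Y. E \<le> ennreal \<epsilon> \<and>
      J (\<lambda>x. (u x)\<^sup>2 / norm x ^ 4 * W x) \<le> ennreal (4 / a ^ 4) * E + ennreal 2 * X1 \<and>
      J (\<lambda>x. (norm (weak_gradient ?\<Omega> u x))\<^sup>2 / (norm x)\<^sup>2 * W x) \<le> ennreal (4 / a\<^sup>2) * E + ennreal 2 * X2 \<and>
      X1 \<le> ennreal ?c * Y \<and> X2 \<le> ennreal ?c * Y \<and>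
      Y \<le> ennreal 2 * J (\<lambda>x. (L_op m ?\<Omega> u x)\<^sup>2) + ennreal l * E" if \<epsilon>: "\<epsilon> > 0" for \<epsilon>
  proof -
    obtain \<phi> where \<phi>: "\<phi> \<in> test_functions ?\<Omega>" and
      "(\<integral>\<^sup>+x. ennreal ((u x - \<phi> x)\<^sup>2 + (\<Sum>i\<in>UNIV. (weak_partial ?\<Omega> i u x - partial i \<phi> x)\<^sup>2) +
         (\<Sum>i\<in>UNIV. \<Sum>j\<in>UNIV. (weak_partial ?\<Omega> j (weak_partial ?\<Omega> i u) x - partial j (partial i \<phi>) x)\<^sup>2))
         \<partial>lebesgue_on ?\<Omega>) \<le> ennreal \<epsilon>"
      by (rule W22_0_approx[OF annulus_open u \<epsilon>])
    then have small: "J (\<lambda>x. (u x - \<phi> x)\<^sup>2 + (\<Sum>i\<in>UNIV. (p i x - partial i \<phi> x)\<^sup>2) +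
         (\<Sum>i\<in>UNIV. \<Sum>j\<in>UNIV. (q i j x - partial j (partial i \<phi>) x)\<^sup>2)) \<le> ennreal \<epsilon>"
      unfolding p_def q_def J_def by simp
    have smooth: "smooth \<phi>" using \<phi> by (simp add: test_functions_def)
    have [measurable]: "\<phi> \<in> borel_measurable (lebesgue_on ?\<Omega>)" "partial i \<phi> \<in> borel_measurable (lebesgue_on ?\<Omega>)"
      "partial j (partial i \<phi>) \<in> borel_measurable (lebesgue_on ?\<Omega>)" for i j
      by (intro continuous_measurable_lebesgue_on annulus_open smooth_continuous_on smooth_partial smooth)+
    define e where "e x = (u x - \<phi> x)\<^sup>2 + (\<Sum>i\<in>UNIV. (p i x - partial i \<phi> x)\<^sup>2) +
         (\<Sum>i\<in>UNIV. \<Sum>j\<in>UNIV. (q i j x - partial j (partial i \<phi>) x)\<^sup>2)" for x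
    have e_eq: "e x = (u x - \<phi> x)\<^sup>2 + (p 1 x - partial 1 \<phi> x)\<^sup>2 + (p 2 x - partial 2 \<phi> x)\<^sup>2
       + (q 1 1 x - partial 1 (partial 1 \<phi>) x)\<^sup>2 + (q 1 2 x - partial 2 (partial 1 \<phi>) x)\<^sup>2
       + (q 2 1 x - partial 1 (partial 2 \<phi>) x)\<^sup>2 + (q 2 2 x - partial 2 (partial 2 \<phi>) x)\<^sup>2" for x
      by (simp add: e_def sum_2)
    have e_nonneg: "0 \<le> e x" for x by (simp add: e_eq)
    have [measurable]: "e \<in> borel_measurable (lebesgue_on ?\<Omega>)"
      unfolding e_eq[abs_def] by measurable
    have space: "space (lebesgue_on ?\<Omega>) = ?\<Omega>" by simp
    \<comment> \<open>With W \<le> 2 and |x| \<ge> a, the factor 2 of (y - z)^2 becomes 2 * 2 / a^k;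
      the weight stays on z.\<close>
    have weighted: "y\<^sup>2 * (W x / norm x ^ k) \<le> 4 / a ^ k * (y - z)\<^sup>2 + 2 * (z\<^sup>2 * (W x / norm x ^ k))"
      if x: "x \<in> ?\<Omega>" for x y z and k :: nat
    proof -
      have "norm x ^ k \<ge> a ^ k" using annulus_norm[OF a x] a by (intro power_mono) auto
      then have "W x / norm x ^ k \<le> 2 / a ^ k"
        using W_bounds[OF x] a by (intro frac_le) auto
      then have "2 * (y - z)\<^sup>2 * (W x / norm x ^ k) \<le> 2 * (y - z)\<^sup>2 * (2 / a ^ k)"
        by (intro mult_left_mono) auto
      moreover have "y\<^sup>2 * (W x / norm x ^ k) \<le> (2 * z\<^sup>2 + 2 * (y - z)\<^sup>2) * (W x / norm x ^ k)"
        using W_bounds[OF x] by (intro mult_right_mono square_le_2_diff_square) auto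
      moreover have "2 * (y - z)\<^sup>2 * (2 / a ^ k) = 4 / a ^ k * (y - z)\<^sup>2"
        by simp
      ultimately show ?thesis by (simp only: distrib_right mult.assoc)
    qed
    have A1: "J (\<lambda>x. (u x)\<^sup>2 / norm x ^ 4 * W x) \<le> ennreal (4 / a ^ 4) * J e + ennreal 2 * J (\<lambda>x. (\<phi> x)\<^sup>2 / norm x ^ 4 * W x)"
      unfolding J_def
    proof (rule nn_integral_le_linear_combination)
      fix x assume "x \<in> space (lebesgue_on ?\<Omega>)"
      then have x: "x \<in> ?\<Omega>" by simp
      have "4 / a ^ 4 * (u x - \<phi> x)\<^sup>2 \<le> 4 / a ^ 4 * e x"
        using a by (intro mult_left_mono) (auto simp: e_eq)
      with weighted[OF x, of "u x" 4 "\<phi> x"]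
      show "(u x)\<^sup>2 / norm x ^ 4 * W x \<le> 4 / a ^ 4 * e x + 2 * ((\<phi> x)\<^sup>2 / norm x ^ 4 * W x)"
        by simp
    qed (use a e_nonneg W_bounds in \<open>auto\<close>)
    have A2: "J (\<lambda>x. (norm (weak_gradient ?\<Omega> u x))\<^sup>2 / (norm x)\<^sup>2 * W x) \<le> ennreal (4 / a\<^sup>2) * J e
        + ennreal 2 * J (\<lambda>x. ((partial 1 \<phi> x)\<^sup>2 + (partial 2 \<phi> x)\<^sup>2) / (norm x)\<^sup>2 * W x)"
      unfolding J_def grad
    proof (rule nn_integral_le_linear_combination)
      fix x assume "x \<in> space (lebesgue_on ?\<Omega>)"
      then have x: "x \<in> ?\<Omega>" by simp
      have "4 / a\<^sup>2 * ((p 1 x - partial 1 \<phi> x)\<^sup>2 + (p 2 x - partial 2 \<phi> x)\<^sup>2) \<le> 4 / a\<^sup>2 * e x"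
        using a by (intro mult_left_mono) (auto simp: e_eq)
      with weighted[OF x, of "p 1 x" 2 "partial 1 \<phi> x"] weighted[OF x, of "p 2 x" 2 "partial 2 \<phi> x"]
      show "((p 1 x)\<^sup>2 + (p 2 x)\<^sup>2) / (norm x)\<^sup>2 * W x
          \<le> 4 / a\<^sup>2 * e x + 2 * (((partial 1 \<phi> x)\<^sup>2 + (partial 2 \<phi> x)\<^sup>2) / (norm x)\<^sup>2 * W x)"
        by (simp add: distrib_left distrib_right add_divide_distrib)
    qed (use a e_nonneg W_bounds in \<open>auto\<close>)
    have A3: "J (\<lambda>x. (classical_L m \<phi> x)\<^sup>2) \<le> ennreal 2 * J (\<lambda>x. (L_op m ?\<Omega> u x)\<^sup>2) + ennreal l * J e"
      unfolding J_def
    proof (rule nn_integral_le_linear_combination)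
      fix x assume "x \<in> space (lebesgue_on ?\<Omega>)"
      then have x: "x \<in> ?\<Omega>" by simp
      have r: "(norm x)\<^sup>2 \<ge> a\<^sup>2" "(norm x)\<^sup>2 > 0"
        using annulus_norm[OF a x] a by (auto intro!: power_mono)
      let ?c1 = "2 * (m - 1) * x $ 1 / (norm x)\<^sup>2" and ?c2 = "2 * (m - 1) * x $ 2 / (norm x)\<^sup>2"
        and ?c3 = "(m - 1)\<^sup>2 / (norm x)\<^sup>2"
      \<comment> \<open>The squares of the two coordinates add up to |x|^2, leaving 4 (m - 1)^2 /
        |x|^2.\<close>
      have "?c1\<^sup>2 + ?c2\<^sup>2 = 4 * (m - 1)\<^sup>2 * ((x $ 1)\<^sup>2 + (x $ 2)\<^sup>2) / ((norm x)\<^sup>2)\<^sup>2"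
        by (simp only: power_mult_distrib power_divide distrib_left add_divide_distrib) simp
      also have "\<dots> = 4 * (m - 1)\<^sup>2 / (norm x)\<^sup>2"
      proof -
        have "k * t / t\<^sup>2 = k / t" for k t :: real
          by (simp add: power2_eq_square)
        then show ?thesis unfolding norm_sq_2[symmetric] .
      qed
      also have "\<dots> \<le> 4 * (m - 1)\<^sup>2 / a\<^sup>2"
        using r a by (intro divide_left_mono) auto
      finally have c12: "?c1\<^sup>2 + ?c2\<^sup>2 \<le> 4 * (m - 1)\<^sup>2 / a\<^sup>2" .
      have "?c3 \<le> (m - 1)\<^sup>2 / a\<^sup>2"
        using r a by (intro divide_left_mono) auto
      then have "?c3\<^sup>2 \<le> ((m - 1)\<^sup>2 / a\<^sup>2)\<^sup>2"
        by (intro power_mono) auto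
      then have c3: "?c3\<^sup>2 \<le> (m - 1) ^ 4 / a ^ 4"
        by (simp add: power_divide flip: power_mult)
      define s where "s = (q 1 1 x - partial 1 (partial 1 \<phi>) x)\<^sup>2 + (q 2 2 x - partial 2 (partial 2 \<phi>) x)\<^sup>2
        + (p 1 x - partial 1 \<phi> x)\<^sup>2 + (p 2 x - partial 2 \<phi> x)\<^sup>2 + (u x - \<phi> x)\<^sup>2"
      have s: "0 \<le> s" "s \<le> e x" by (simp_all add: s_def e_eq)
      have "L_op m ?\<Omega> u x - classical_L m \<phi> x =
          (q 1 1 x - partial 1 (partial 1 \<phi>) x) + (q 2 2 x - partial 2 (partial 2 \<phi>) x)
          + ?c1 * (p 1 x - partial 1 \<phi> x) + ?c2 * (p 2 x - partial 2 \<phi> x) + ?c3 * (u x - \<phi> x)"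
        by (simp add: L_op_eq classical_L_def p_def q_def add_divide_distrib diff_divide_distrib algebra_simps)
      then have "(classical_L m \<phi> x - L_op m ?\<Omega> u x)\<^sup>2 \<le> (2 + (?c1\<^sup>2 + ?c2\<^sup>2) + ?c3\<^sup>2) * s"
        unfolding s_def by (simp only: power2_commute[of "classical_L m \<phi> x"] Cauchy_Schwarz_5)
      also have "\<dots> \<le> (2 + 4 * (m - 1)\<^sup>2 / a\<^sup>2 + (m - 1) ^ 4 / a ^ 4) * e x"
        using c12 c3 s a by (intro mult_mono add_mono) auto
      finally have "2 * (classical_L m \<phi> x - L_op m ?\<Omega> u x)\<^sup>2 \<le> l * e x"
        unfolding l_def mult.assoc by (rule mult_left_mono) simp
      with square_le_2_diff_square[of "classical_L m \<phi> x" "L_op m ?\<Omega> u x"]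
      show "(classical_L m \<phi> x)\<^sup>2 \<le> 2 * (L_op m ?\<Omega> u x)\<^sup>2 + l * e x"
        by linarith
    qed (use l e_nonneg in \<open>auto\<close>)
    have "J e \<le> ennreal \<epsilon>" using small by (simp add: e_def[abs_def])
    moreover have "J (\<lambda>x. (\<phi> x)\<^sup>2 / norm x ^ 4 * W x) \<le> ennreal ?c * J (\<lambda>x. (classical_L m \<phi> x)\<^sup>2)"
      "J (\<lambda>x. ((partial 1 \<phi> x)\<^sup>2 + (partial 2 \<phi> x)\<^sup>2) / (norm x)\<^sup>2 * W x)
        \<le> ennreal ?c * J (\<lambda>x. (classical_L m \<phi> x)\<^sup>2)"
      unfolding W_def J_def by (rule test_function_estimate[OF a \<phi> m0 \<alpha>])+
    ultimately show ?thesis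
      using A1 A2 A3 by (intro exI conjI)
  qed
  have "J (\<lambda>x. (u x)\<^sup>2 / norm x ^ 4 * W x) \<le> ennreal (4 * ?c) * J (\<lambda>x. (L_op m ?\<Omega> u x)\<^sup>2)"
  proof (rule ennreal_le_absorb_error[of "4 / a ^ 4" l ?c])
    fix \<epsilon> :: real assume "\<epsilon> > 0"
    then show "\<exists>E X Y. E \<le> ennreal \<epsilon> \<and> J (\<lambda>x. (u x)\<^sup>2 / norm x ^ 4 * W x) \<le> ennreal (4 / a ^ 4) * E + ennreal 2 * X \<and>
        X \<le> ennreal ?c * Y \<and> Y \<le> ennreal 2 * J (\<lambda>x. (L_op m ?\<Omega> u x)\<^sup>2) + ennreal l * E"
      using approx by blast
  qed (use a l c in auto)
  then show "J (\<lambda>x. (u x)\<^sup>2 / norm x ^ 4 * W x)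
      \<le> ennreal (8 * energy_const m \<alpha>) * J (\<lambda>x. (L_op m ?\<Omega> u x)\<^sup>2)" by simp
  have "J (\<lambda>x. (norm (weak_gradient ?\<Omega> u x))\<^sup>2 / (norm x)\<^sup>2 * W x) \<le> ennreal (4 * ?c) * J (\<lambda>x. (L_op m ?\<Omega> u x)\<^sup>2)"
  proof (rule ennreal_le_absorb_error[of "4 / a\<^sup>2" l ?c])
    fix \<epsilon> :: real assume "\<epsilon> > 0"
    then show "\<exists>E X Y. E \<le> ennreal \<epsilon> \<and> J (\<lambda>x. (norm (weak_gradient ?\<Omega> u x))\<^sup>2 / (norm x)\<^sup>2 * W x) \<le> ennreal (4 / a\<^sup>2) * E + ennreal 2 * X \<and>
        X \<le> ennreal ?c * Y \<and> Y \<le> ennreal 2 * J (\<lambda>x. (L_op m ?\<Omega> u x)\<^sup>2) + ennreal l * E"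
      using approx by blast
  qed (use a l c in auto)
  then show "J (\<lambda>x. (norm (weak_gradient ?\<Omega> u x))\<^sup>2 / (norm x)\<^sup>2 * W x)
      \<le> ennreal (8 * energy_const m \<alpha>) * J (\<lambda>x. (L_op m ?\<Omega> u x)\<^sup>2)" by simp
qed

theorem theorem2p1:
  fixes m \<alpha> :: real
  assumes "m > 1" and "\<alpha> > 0"
  shows "\<exists>C::real. \<forall>a b::real. 0 < a \<and> a < b \<longrightarrow>
    (\<forall>u \<in> W22_0 (annulus a b).
      (\<integral>\<^sup>+x\<in>annulus a b. ennreal ((u x)\<^sup>2 / norm x ^ 4 *
          ((norm x / b) powr \<alpha> + (a / norm x) powr \<alpha>)) \<partial>lebesgue)
        \<le> ennreal C * (\<integral>\<^sup>+x\<in>annulus a b. ennreal ((L_op m (annulus a b) u x)\<^sup>2) \<partial>lebesgue) \<and>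
      (\<integral>\<^sup>+x\<in>annulus a b. ennreal ((norm (weak_gradient (annulus a b) u x))\<^sup>2 / (norm x)\<^sup>2 *
          ((norm x / b) powr \<alpha> + (a / norm x) powr \<alpha>)) \<partial>lebesgue)
        \<le> ennreal C * (\<integral>\<^sup>+x\<in>annulus a b. ennreal ((L_op m (annulus a b) u x)\<^sup>2) \<partial>lebesgue))"
proof (intro exI[of _ "8 * energy_const m \<alpha>"] allI impI ballI)
  fix a b :: real and u
  assume ab: "0 < a \<and> a < b" and u: "u \<in> W22_0 (annulus a b)"
  have "(\<integral>\<^sup>+x\<in>annulus a b. f x \<partial>lebesgue) = (\<integral>\<^sup>+x. f x \<partial>lebesgue_on (annulus a b))" for f
    by (rule nn_integral_restrict_space[OF open_lebesgue[OF annulus_open], symmetric])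
  then show "(\<integral>\<^sup>+x\<in>annulus a b. ennreal ((u x)\<^sup>2 / norm x ^ 4 *
          ((norm x / b) powr \<alpha> + (a / norm x) powr \<alpha>)) \<partial>lebesgue)
        \<le> ennreal (8 * energy_const m \<alpha>) *
          (\<integral>\<^sup>+x\<in>annulus a b. ennreal ((L_op m (annulus a b) u x)\<^sup>2) \<partial>lebesgue) \<and>
      (\<integral>\<^sup>+x\<in>annulus a b. ennreal ((norm (weak_gradient (annulus a b) u x))\<^sup>2 / (norm x)\<^sup>2 *
          ((norm x / b) powr \<alpha> + (a / norm x) powr \<alpha>)) \<partial>lebesgue)
        \<le> ennreal (8 * energy_const m \<alpha>) *
          (\<integral>\<^sup>+x\<in>annulus a b. ennreal ((L_op m (annulus a b) u x)\<^sup>2) \<partial>lebesgue)"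
    using W22_0_estimate[OF assms _ u] ab by simp
qed

end
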